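(* Fix an integer $d\ge 1$ and $\lambda\in(0,1)$. For each integer $n\ge d$, the Markov chain $X^n(\cdot)$ defined in the context is positive recurrent. Furthermore, if for $j\in[n]$ the random variable $Q^n_j(\infty)$ has the steady-state queue-length distribution of server $j$ (i.e. the law of $\sum_{i\in\partial_j}X^n_i$ when $X^n$ is distributed according to the stationary distribution of the chain), then $$\sup_{n}\mathbb{E}\bigl[Q^n_j(\infty)\bigr]\le\frac{\lambda}{1-\lambda}.$$
   Context: For integers $n\ge d$ let $[n]=\{1,\dots,n\}$ be the set of servers and $m=\binom{n}{d}$. The $m$ subsets of $[n]$ of size $d$ are called classes and are indexed by $i\in[m]$. For a class $i\in[m]$, $\partial_i\subset[n]$ denotes the corresponding set of $d$ servers; for a server $j\in[n]$, $\partial_j\subset[m]$ denotes the set of the $\binom{n-1}{d-1}$ classes containing $j$. The process $X^n(\cdot)=(X^n_i(\cdot),i\in[m])$ is the continuous-time Markov chain on $S^n=\mathbb{Z}_+^m$ ($X_i^n(t)$ is the number of class-$i$ jobs at time $t$) with transitions, from $x\in S^n$ and for each $i\in[m]$, $$x\to x+e_i\ \text{ at rate } r^{i,n}_+(x)=\frac{n\lambda}{m},\qquad x\to x-e_i\ \text{ at rate } r^{i,n}_-(x)=x_i\sum_{j\in\partial_i}\frac1{q_j},\qquad q_j=\sum_{i'\in\partial_j}x_{i'},$$ where $e_i$ is the $i$-th unit vector and $r^{i,n}_-(x)=0$ when $x_i=0$. The queue length at server $j$ at time $t$ is $Q^n_j(t)=\sum_{i\in\partial_j}X^n_i(t)$.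 *)

theory Defs
  imports "HOL-Probability.Probability"
begin

section \<open>Continuous-time Markov chains with given transition rates\<close>

text \<open>
  A chain is given by its off-diagonal transition rates \<open>rate x y\<close>; the values \<open>rate x x\<close> are
  ignored. It is built from its jump chain and its holding times. All states of the type are
  allowed here; a state space \<open>S\<close> (closed under the transitions) is a separate parameter below.
\<close>

definition exit_rate :: "('s \<Rightarrow> 's \<Rightarrow> real) \<Rightarrow> 's \<Rightarrow> real" where
  "exit_rate rate x = infsum (rate x) (- {x})"

definition jump_pmf :: "('s \<Rightarrow> 's \<Rightarrow> real) \<Rightarrow> 's \<Rightarrow> 's pmf" where
  "jump_pmf rate x =
     (if exit_rate rate x = 0 then return_pmf x
      else embed_pmf (\<lambda>y. if y = x then 0 else rate x y / exit_rate rate x))"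

lemma pmf_jump_pmf:
  assumes nonneg: "\<And>y. 0 \<le> rate x y" and fin: "finite {y. rate x y \<noteq> 0}"
    and "exit_rate rate x \<noteq> 0"
  shows "pmf (jump_pmf rate x) y = (if y = x then 0 else rate x y / exit_rate rate x)"
proof -
  define F where "F = {y. rate x y \<noteq> 0} - {x}"
  have F: "finite F" using fin by (simp add: F_def)
  have "exit_rate rate x = infsum (rate x) F"
    unfolding exit_rate_def by (rule infsum_cong_neutral) (auto simp: F_def)
  then have e: "exit_rate rate x = sum (rate x) F"
    using F by simp
  have pos: "exit_rate rate x > 0"
    using assms(3) nonneg by (simp add: e order_less_le sum_nonneg)
  let ?f = "\<lambda>y. if y = x then 0 else rate x y / exit_rate rate x"
  have "(\<integral>\<^sup>+ y. ennreal (?f y) \<partial>count_space UNIV) = (\<Sum>y\<in>F. ennreal (?f y))"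
    by (rule nn_integral_count_space'[OF F]) (auto simp: F_def)
  also have "\<dots> = ennreal (\<Sum>y\<in>F. ?f y)"
    using pos nonneg by (intro sum_ennreal) auto
  also have "(\<Sum>y\<in>F. ?f y) = (\<Sum>y\<in>F. rate x y / exit_rate rate x)"
    by (rule sum.cong) (auto simp: F_def)
  also have "\<dots> = 1"
    using pos by (simp add: sum_divide_distrib[symmetric] e)
  finally have 1: "(\<integral>\<^sup>+ y. ennreal (?f y) \<partial>count_space UNIV) = 1"
    by simp
  show ?thesis
    using assms(3) pos nonneg by (simp add: jump_pmf_def pmf_embed_pmf[OF _ 1])
qed

text \<open>The law of a discrete-time Markov chain with initial law \<open>\<mu>\<close> and transition kernel \<open>K\<close>.\<close>

definition chain_kernel :: "'s pmf \<Rightarrow> ('s \<Rightarrow> 's pmf) \<Rightarrow> nat \<Rightarrow> (nat \<Rightarrow> 's) \<Rightarrow> 's measure" where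
  "chain_kernel \<mu> K k Y = measure_pmf (case k of 0 \<Rightarrow> \<mu> | Suc l \<Rightarrow> K (Y l))"

lemma Ionescu_Tulcea_chain_kernel: "Ionescu_Tulcea (chain_kernel \<mu> K) (\<lambda>_. count_space UNIV)"
proof (rule Ionescu_Tulcea.intro)
  fix i :: nat
  show "chain_kernel \<mu> K i \<in> measurable (PiM {0..<i} (\<lambda>_. count_space UNIV)) (subprob_algebra (count_space UNIV))"
  proof (cases i)
    case 0
    then show ?thesis
      by (auto simp: chain_kernel_def[abs_def] measure_pmf_in_subprob_algebra)
  next
    case (Suc l)
    have "(\<lambda>Y. measure_pmf (K (Y l))) \<in>
        measurable (PiM {0..<Suc l} (\<lambda>_. count_space UNIV)) (subprob_algebra (count_space UNIV))"
      by (rule measurable_compose[where N = "count_space UNIV"])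
         (auto intro!: measurable_component_singleton simp: measure_pmf_in_subprob_algebra)
    then show ?thesis
      by (simp add: Suc chain_kernel_def[abs_def])
  qed
next
  fix i Y
  show "prob_space (chain_kernel \<mu> K i Y)"
    by (simp add: chain_kernel_def measure_pmf.prob_space_axioms)
qed

definition jump_chain_measure :: "'s pmf \<Rightarrow> ('s \<Rightarrow> 's pmf) \<Rightarrow> (nat \<Rightarrow> 's) measure" where
  "jump_chain_measure \<mu> K =
     projective_family.lim UNIV
       (Ionescu_Tulcea.CI (chain_kernel \<mu> K) (\<lambda>_. count_space UNIV)) (\<lambda>_. count_space UNIV)"

text \<open>
  A sample point is a pair \<open>(Y, E)\<close> of the jump chain and an independent sequence of independent
  standard exponential variables. The holding time in the \<open>k\<close>-th visited state is
  \<open>E k / exit_rate rate (Y k)\<close>, which is infinite in an absorbing state.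
\<close>

definition ctmc_measure ::
    "('s \<Rightarrow> 's \<Rightarrow> real) \<Rightarrow> 's pmf \<Rightarrow> ((nat \<Rightarrow> 's) \<times> (nat \<Rightarrow> real)) measure" where
  "ctmc_measure rate \<mu> =
     jump_chain_measure \<mu> (jump_pmf rate) \<Otimes>\<^sub>M
     PiM UNIV (\<lambda>_. density lborel (\<lambda>t. ennreal (exponential_density 1 t)))"

definition jump_time ::
    "('s \<Rightarrow> 's \<Rightarrow> real) \<Rightarrow> (nat \<Rightarrow> 's) \<times> (nat \<Rightarrow> real) \<Rightarrow> nat \<Rightarrow> ennreal" where
  "jump_time rate \<omega> k = (\<Sum>i<k. ennreal (snd \<omega> i) / ennreal (exit_rate rate (fst \<omega> i)))"

text \<open>The state at time \<open>t\<close>; it is \<open>None\<close> from the explosion time on.\<close>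

definition ctmc_at ::
    "('s \<Rightarrow> 's \<Rightarrow> real) \<Rightarrow> (nat \<Rightarrow> 's) \<times> (nat \<Rightarrow> real) \<Rightarrow> real \<Rightarrow> 's option" where
  "ctmc_at rate \<omega> t =
     (if \<exists>k. ennreal t < jump_time rate \<omega> (Suc k)
      then Some (fst \<omega> (LEAST k. ennreal t < jump_time rate \<omega> (Suc k)))
      else None)"

definition return_time ::
    "('s \<Rightarrow> 's \<Rightarrow> real) \<Rightarrow> 's \<Rightarrow> (nat \<Rightarrow> 's) \<times> (nat \<Rightarrow> real) \<Rightarrow> ennreal" where
  "return_time rate x \<omega> =
     Inf {ennreal t | t. 0 \<le> t \<and> jump_time rate \<omega> 1 \<le> ennreal t \<and> ctmc_at rate \<omega> t = Some x}"

definition irreducible_ctmc :: "'s set \<Rightarrow> ('s \<Rightarrow> 's \<Rightarrow> real) \<Rightarrow> bool" where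
  "irreducible_ctmc S rate \<longleftrightarrow>
     (\<forall>x\<in>S. \<forall>y\<in>S. \<exists>t\<ge>0. \<P>(\<omega> in ctmc_measure rate (return_pmf x). ctmc_at rate \<omega> t = Some y) > 0)"

definition positive_recurrent_state :: "('s \<Rightarrow> 's \<Rightarrow> real) \<Rightarrow> 's \<Rightarrow> bool" where
  "positive_recurrent_state rate x \<longleftrightarrow>
     exit_rate rate x = 0 \<or>
     (\<integral>\<^sup>+ \<omega>. return_time rate x \<omega> \<partial>ctmc_measure rate (return_pmf x)) < \<infinity>"

definition positive_recurrent_ctmc :: "'s set \<Rightarrow> ('s \<Rightarrow> 's \<Rightarrow> real) \<Rightarrow> bool" where
  "positive_recurrent_ctmc S rate \<longleftrightarrow>
     irreducible_ctmc S rate \<and> (\<forall>x\<in>S. positive_recurrent_state rate x)"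

definition stationary_distribution :: "'s set \<Rightarrow> ('s \<Rightarrow> 's \<Rightarrow> real) \<Rightarrow> 's pmf \<Rightarrow> bool" where
  "stationary_distribution S rate \<pi> \<longleftrightarrow>
     set_pmf \<pi> \<subseteq> S \<and>
     (\<forall>t\<ge>0. \<forall>y\<in>S. \<P>(\<omega> in ctmc_measure rate \<pi>. ctmc_at rate \<omega> t = Some y) = pmf \<pi> y)"

section \<open>The queueing network\<close>

text \<open>
  Classes are indexed by themselves rather than by \<open>{1..n choose d}\<close>, so a state maps each class to
  its number of jobs and is \<open>0\<close> on sets that are not classes.
\<close>

definition classes :: "nat \<Rightarrow> nat \<Rightarrow> nat set set" where
  "classes n d = {c. c \<subseteq> {1..n} \<and> card c = d}"

definition states :: "nat \<Rightarrow> nat \<Rightarrow> (nat set \<Rightarrow> nat) set" where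
  "states n d = {x. \<forall>c. c \<notin> classes n d \<longrightarrow> x c = 0}"

definition queue_length :: "nat \<Rightarrow> nat \<Rightarrow> (nat set \<Rightarrow> nat) \<Rightarrow> nat \<Rightarrow> nat" where
  "queue_length n d x j = (\<Sum>c\<in>{c \<in> classes n d. j \<in> c}. x c)"

definition arrival_rate :: "nat \<Rightarrow> nat \<Rightarrow> real \<Rightarrow> real" where
  "arrival_rate n d lam = real n * lam / real (n choose d)"

definition departure_rate :: "nat \<Rightarrow> nat \<Rightarrow> (nat set \<Rightarrow> nat) \<Rightarrow> nat set \<Rightarrow> real" where
  "departure_rate n d x c =
     (if x c = 0 then 0 else real (x c) * (\<Sum>j\<in>c. 1 / real (queue_length n d x j)))"

definition network_rate ::
    "nat \<Rightarrow> nat \<Rightarrow> real \<Rightarrow> (nat set \<Rightarrow> nat) \<Rightarrow> (nat set \<Rightarrow> nat) \<Rightarrow> real" where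
  "network_rate n d lam x y =
     (\<Sum>c\<in>classes n d.
        (if y = x(c := x c + 1) then arrival_rate n d lam else 0) +
        (if x c > 0 \<and> y = x(c := x c - 1) then departure_rate n d x c else 0))"

end

theory Submission
  imports Defs
begin

text \<open>
  All exit rates of the chain lie between \<open>n \<lambda>\<close> and \<open>n \<lambda> + n\<close>. By the Cauchy--Schwarz inequality
  \<open>d\<^sup>2 \<le> (\<Sum>j\<in>c. 1 / q j) (\<Sum>j\<in>c. q j)\<close> in each class \<open>c\<close>, the function \<open>\<Sum>j. (q j)\<^sup>2\<close> has drift at
  most \<open>- 2 d (1 - \<lambda>) (\<Sum>j. q j) + d (\<lambda> n + b)\<close>, where \<open>b \<le> n\<close> is the number of busy servers. The drift is
  very negative outside a finite set, which gives positive recurrence by Foster's criterion. In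
  equilibrium the drift of \<open>\<Sum>j. q j\<close> shows that \<open>b\<close> has mean at most \<open>\<lambda> n\<close>, so that
  \<open>\<Sum>j. q j\<close> has mean at most \<open>n \<lambda> / (1 - \<lambda>)\<close>. The stationary distribution is unique, hence invariant
  under permutations of the servers, and every server carries the same share of this mean.
\<close>

section \<open>The jump chain\<close>

text \<open>Stationarity is a statement about the law of the path at every time \<open>t\<close>, so
  it must first be turned into a statement about rates. An exact treatment would have to control
  trajectories with many jumps. Lower bounds on a few explicit events give only an inequality,
  inflow at most outflow, and the later arguments are arranged so that this inequality suffices:
  moment bounds test it with nonnegative functions, and uniqueness recovers equality from
  conservation of mass. The first-moment drift is what makes the constant sharp. The pointwise bound
  \<open>busy x\<close> \<le> \<open>n\<close> in the drift of the sum of squares would only give (1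
  + \<lambda>) / (2 (1 - \<lambda>)) per server; replacing \<open>n\<close> by the mean bound
  \<lambda> \<open>n\<close> turns the numerator into 2 \<lambda>.\<close>

lemma sets_jump_chain_measure [measurable_cong, simp]:
  "sets (jump_chain_measure \<mu> K) = sets (PiM UNIV (\<lambda>_. count_space UNIV))"
proof -
  interpret Ionescu_Tulcea "chain_kernel \<mu> K" "\<lambda>_. count_space UNIV"
    by (rule Ionescu_Tulcea_chain_kernel)
  show ?thesis
    by (simp add: jump_chain_measure_def)
qed

lemma space_jump_chain_measure [simp]: "space (jump_chain_measure \<mu> K) = UNIV"
  using sets_eq_imp_space_eq[OF sets_jump_chain_measure, of \<mu> K] by (simp add: space_PiM)

lemma measurable_coordinate:
  fixes h :: "'s \<Rightarrow> ennreal"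
  assumes "i \<in> I"
  shows "(\<lambda>\<omega>. h (\<omega> i)) \<in> borel_measurable (PiM I (\<lambda>_. count_space UNIV))"
  by (rule measurable_compose[OF measurable_component_singleton[OF assms]]) simp

section \<open>Finite marginals and the Markov property of the jump chain\<close>

context
  fixes \<mu> :: "'s pmf" and K :: "'s \<Rightarrow> 's pmf"
begin

interpretation Ionescu_Tulcea "chain_kernel \<mu> K" "\<lambda>_. count_space UNIV"
  by (rule Ionescu_Tulcea_chain_kernel)

text \<open>The projective limit is known through its marginals \<open>CI J\<close>. For an initial
  segment \<open>J\<close>, the bound \<open>up_to J\<close> is its length, so \<open>CI J\<close>
  collapses to the kernel composition started from the empty history.\<close>

private lemma distr_jump_chain:
  "distr (jump_chain_measure \<mu> K) (PiM {0..<n} (\<lambda>_. count_space UNIV)) (\<lambda>x. restrict x {0..<n})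
    = C 0 n (\<lambda>_. undefined)"
proof -
  have u: "up_to {0..<n} = n"
  proof (rule antisym)
    show "n \<le> up_to {0..<n}"
      using up_to_less[of "{0..<n}" "n - 1"] by (cases n) auto
  qed (simp add: up_to_iff)
  have "CI {0..<n} = C 0 n (\<lambda>_. undefined)"
    using distr_C[of n n "\<lambda>_. undefined" 0] by (simp add: CI_def u)
  then show ?thesis
    using distr_lim[of "{0..<n}"] by (simp add: jump_chain_measure_def)
qed

private lemma nn_integral_jump_chain:
  assumes [measurable]: "f \<in> borel_measurable (PiM {0..<n} (\<lambda>_. count_space UNIV))"
  shows "(\<integral>\<^sup>+\<omega>. f (restrict \<omega> {0..<n}) \<partial>jump_chain_measure \<mu> K) = (\<integral>\<^sup>+\<omega>. f \<omega> \<partial>C 0 n (\<lambda>_. undefined))"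
  unfolding distr_jump_chain[symmetric]
  by (subst nn_integral_distr) (auto intro!: measurable_restrict measurable_component_singleton
      simp: measurable_cong_sets[OF sets_jump_chain_measure refl])

private lemma nn_integral_C_Suc:
  assumes [measurable]: "f \<in> borel_measurable (PiM {0..<Suc n} (\<lambda>_. count_space UNIV))"
  shows "(\<integral>\<^sup>+\<omega>. f \<omega> \<partial>C 0 (Suc n) (\<lambda>_. undefined)) =
    (\<integral>\<^sup>+\<omega>. (\<integral>\<^sup>+x. f (fun_upd \<omega> n x) \<partial>chain_kernel \<mu> K n \<omega>) \<partial>C 0 n (\<lambda>_. undefined))"
proof -
  have [measurable]: "eP n \<in> measurable (C 0 n (\<lambda>_. undefined)) (subprob_algebra (PiM {0..<Suc n} (\<lambda>_. count_space UNIV)))"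
    using measurable_eP[of n] sets_C[of "\<lambda>_. undefined" 0 n] by (simp cong: measurable_cong_sets)
  have "(\<integral>\<^sup>+\<omega>. f \<omega> \<partial>C 0 (Suc n) (\<lambda>_. undefined)) = (\<integral>\<^sup>+\<omega>. (\<integral>\<^sup>+x. f x \<partial>eP n \<omega>) \<partial>C 0 n (\<lambda>_. undefined))"
    by (simp add: nn_integral_bind[where B="PiM {0 ..< Suc n} (\<lambda>_. count_space UNIV)"])
  also have "\<dots> = (\<integral>\<^sup>+\<omega>. (\<integral>\<^sup>+x. f (fun_upd \<omega> n x) \<partial>chain_kernel \<mu> K n \<omega>) \<partial>C 0 n (\<lambda>_. undefined))"
    using space_C[of "\<lambda>_. undefined" 0 n] by (intro nn_integral_cong nn_integral_eP) auto
  finally show ?thesis .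
qed

lemma prob_space_jump_chain: "prob_space (jump_chain_measure \<mu> K)"
proof
  have "(\<integral>\<^sup>+\<omega>. 1 \<partial>jump_chain_measure \<mu> K) = (\<integral>\<^sup>+\<omega>. 1 \<partial>C 0 0 (\<lambda>_. undefined))"
    by (rule nn_integral_jump_chain[of "\<lambda>_. 1" 0]) simp
  also have "\<dots> = 1"
    using prob_space.emeasure_space_1[OF prob_space_C[of "\<lambda>_. undefined" 0 0]] by simp
  finally show "emeasure (jump_chain_measure \<mu> K) (space (jump_chain_measure \<mu> K)) = 1"
    by simp
qed

lemma nn_integral_jump_chain_0:
  "(\<integral>\<^sup>+\<omega>. f (\<omega> 0) \<partial>jump_chain_measure \<mu> K) = (\<integral>\<^sup>+x. f x \<partial>\<mu>)"
proof -
  have "(\<integral>\<^sup>+\<omega>. f (\<omega> 0) \<partial>jump_chain_measure \<mu> K) =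
      (\<integral>\<^sup>+\<omega>. f (\<omega> 0) \<partial>C 0 (Suc 0) (\<lambda>_. undefined))"
    using nn_integral_jump_chain[OF measurable_coordinate[of 0 "{0..<Suc 0}" f]]
    by (simp del: C.simps)
  also have "\<dots> = (\<integral>\<^sup>+\<omega>. (\<integral>\<^sup>+x. f x \<partial>chain_kernel \<mu> K 0 \<omega>) \<partial>C 0 0 (\<lambda>_. undefined))"
    by (subst nn_integral_C_Suc[OF measurable_coordinate]) simp_all
  also have "\<dots> = (\<integral>\<^sup>+x. f x \<partial>\<mu>)"
    using prob_space.emeasure_space_1[OF prob_space_C[of "\<lambda>_. undefined" 0 0]]
    by (simp add: chain_kernel_def)
  finally show ?thesis .
qed

text \<open>The Markov property at time \<open>k\<close>, stated without conditional expectations.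
  Products of one-coordinate functions are a rich enough past: they include the indicators of
  cylinders and of the events that a state is avoided.\<close>

lemma nn_integral_jump_chain_Suc:
  fixes f :: "nat \<Rightarrow> 's \<Rightarrow> ennreal"
  shows "(\<integral>\<^sup>+\<omega>. (\<Prod>i\<le>k. f i (\<omega> i)) * g (\<omega> (Suc k)) \<partial>jump_chain_measure \<mu> K) =
    (\<integral>\<^sup>+\<omega>. (\<Prod>i\<le>k. f i (\<omega> i)) * (\<integral>\<^sup>+x. g x \<partial>K (\<omega> k)) \<partial>jump_chain_measure \<mu> K)"
proof -
  have [measurable]:
    "(\<lambda>\<omega>. \<Prod>i\<le>k. f i (\<omega> i)) \<in> borel_measurable (PiM {0..<Suc (Suc k)} (\<lambda>_. count_space UNIV))"
    "(\<lambda>\<omega>. \<Prod>i\<le>k. f i (\<omega> i)) \<in> borel_measurable (PiM {0..<Suc k} (\<lambda>_. count_space UNIV))"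
    "(\<lambda>\<omega>. g (\<omega> (Suc k))) \<in> borel_measurable (PiM {0..<Suc (Suc k)} (\<lambda>_. count_space UNIV))"
    "(\<lambda>\<omega>. \<integral>\<^sup>+x. g x \<partial>K (\<omega> k)) \<in> borel_measurable (PiM {0..<Suc k} (\<lambda>_. count_space UNIV))"
    using measurable_coordinate[of "Suc k" "{0..<Suc (Suc k)}" g] measurable_coordinate[of k "{0..<Suc k}" "\<lambda>y. \<integral>\<^sup>+x. g x \<partial>K y"]
    by (auto intro!: borel_measurable_prod_ennreal measurable_coordinate[of i _ "f i" for i])
  have "(\<integral>\<^sup>+\<omega>. (\<Prod>i\<le>k. f i (\<omega> i)) * g (\<omega> (Suc k)) \<partial>jump_chain_measure \<mu> K) =
      (\<integral>\<^sup>+\<omega>. (\<Prod>i\<le>k. f i (\<omega> i)) * g (\<omega> (Suc k)) \<partial>C 0 (Suc (Suc k)) (\<lambda>_. undefined))"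
    using nn_integral_jump_chain[of "\<lambda>\<omega>. (\<Prod>i\<le>k. f i (\<omega> i)) * g (\<omega> (Suc k))" "Suc (Suc k)"]
    by (simp del: C.simps)
  also have "\<dots> = (\<integral>\<^sup>+\<omega>. (\<integral>\<^sup>+x. (\<Prod>i\<le>k. f i (\<omega> i)) * g x \<partial>K (\<omega> k)) \<partial>C 0 (Suc k) (\<lambda>_. undefined))"
    by (subst nn_integral_C_Suc) (auto simp: chain_kernel_def simp del: C.simps intro!: nn_integral_cong)
  also have "\<dots> = (\<integral>\<^sup>+\<omega>. (\<Prod>i\<le>k. f i (\<omega> i)) * (\<integral>\<^sup>+x. g x \<partial>K (\<omega> k)) \<partial>C 0 (Suc k) (\<lambda>_. undefined))"
    by (simp add: nn_integral_cmult del: C.simps)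
  also have "\<dots> = (\<integral>\<^sup>+\<omega>. (\<Prod>i\<le>k. f i (\<omega> i)) * (\<integral>\<^sup>+x. g x \<partial>K (\<omega> k)) \<partial>jump_chain_measure \<mu> K)"
    using nn_integral_jump_chain[of "\<lambda>\<omega>. (\<Prod>i\<le>k. f i (\<omega> i)) * (\<integral>\<^sup>+x. g x \<partial>K (\<omega> k))" "Suc k"]
    by (simp del: C.simps)
  finally show ?thesis .
qed

end

lemma jump_chain_cylinder:
  "emeasure (jump_chain_measure \<mu> K) {\<omega>. \<forall>i\<le>k. \<omega> i = z i} =
    ennreal (pmf \<mu> (z 0) * (\<Prod>i<k. pmf (K (z i)) (z (Suc i))))"
proof -
  let ?M = "jump_chain_measure \<mu> K"
  have meas: "{\<omega>. \<forall>i\<le>k. \<omega> i = z i} \<in> sets ?M" for k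
  proof -
    have "{\<omega> \<in> space (PiM UNIV (\<lambda>_. count_space UNIV)). \<forall>i\<le>k. \<omega> i = z i} \<in>
        sets (PiM UNIV (\<lambda>_. count_space (UNIV :: 'a set)))"
      by measurable
    then show ?thesis
      by (simp add: space_PiM)
  qed
  have prod_eq: "(\<Prod>i\<le>k. indicator {z i} (\<omega> i)) = (indicator {\<omega>. \<forall>i\<le>k. \<omega> i = z i} \<omega> :: ennreal)" for k \<omega>
    by (induction k) (auto simp: indicator_def le_Suc_eq)
  show ?thesis
  proof (induction k)
    case 0
    have "emeasure ?M {\<omega>. \<forall>i\<le>0. \<omega> i = z i} = (\<integral>\<^sup>+\<omega>. indicator {\<omega>. \<forall>i\<le>0. \<omega> i = z i} \<omega> \<partial>?M)"
      using meas[of 0] by (subst nn_integral_indicator) simp_all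
    also have "\<dots> = (\<integral>\<^sup>+\<omega>. indicator {z 0} (\<omega> 0) \<partial>?M)"
      by (intro nn_integral_cong) (auto simp: indicator_def)
    also have "\<dots> = pmf \<mu> (z 0)"
      by (simp add: nn_integral_jump_chain_0[where f = "indicator {z 0}"] emeasure_pmf_single)
    finally show ?case by simp
  next
    case (Suc k)
    have "emeasure ?M {\<omega>. \<forall>i\<le>Suc k. \<omega> i = z i} = (\<integral>\<^sup>+\<omega>. indicator {\<omega>. \<forall>i\<le>Suc k. \<omega> i = z i} \<omega> \<partial>?M)"
      using meas[of "Suc k"] by (subst nn_integral_indicator) simp_all
    also have "\<dots> = (\<integral>\<^sup>+\<omega>. (\<Prod>i\<le>k. indicator {z i} (\<omega> i)) * indicator {z (Suc k)} (\<omega> (Suc k)) \<partial>?M)"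
      unfolding prod_eq[symmetric] by simp
    also have "\<dots> = (\<integral>\<^sup>+\<omega>. (\<Prod>i\<le>k. indicator {z i} (\<omega> i)) *
        (\<integral>\<^sup>+x. indicator {z (Suc k)} x \<partial>K (\<omega> k)) \<partial>?M)"
      by (rule nn_integral_jump_chain_Suc)
    also have "\<dots> = (\<integral>\<^sup>+\<omega>. indicator {\<omega>. \<forall>i\<le>k. \<omega> i = z i} \<omega> * ennreal (pmf (K (z k)) (z (Suc k))) \<partial>?M)"
      unfolding prod_eq
    proof (intro nn_integral_cong)
      fix \<omega>
      show "indicator {\<omega>. \<forall>i\<le>k. \<omega> i = z i} \<omega> * (\<integral>\<^sup>+x. indicator {z (Suc k)} x \<partial>K (\<omega> k)) =
          indicator {\<omega>. \<forall>i\<le>k. \<omega> i = z i} \<omega> * ennreal (pmf (K (z k)) (z (Suc k)))"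
        by (cases "\<forall>i\<le>k. \<omega> i = z i") (simp_all add: emeasure_pmf_single)
    qed
    also have "\<dots> = emeasure ?M {\<omega>. \<forall>i\<le>k. \<omega> i = z i} * ennreal (pmf (K (z k)) (z (Suc k)))"
      using meas[of k] by (simp add: nn_integral_multc)
    also have "\<dots> = ennreal (pmf \<mu> (z 0) * (\<Prod>i<Suc k. pmf (K (z i)) (z (Suc i))))"
      by (simp add: Suc ennreal_mult prod_nonneg mult.assoc)
    finally show ?case .
  qed
qed

section \<open>Sample paths\<close>

abbreviation std_exponential :: "real measure" where
  "std_exponential \<equiv> density lborel (\<lambda>t. ennreal (exponential_density 1 t))"

lemma prob_space_std_exponential: "prob_space std_exponential"
  by (rule prob_space_exponential_density) simp

lemma emeasure_std_exponential_atMost: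
  assumes "0 \<le> a"
  shows "emeasure std_exponential {..a} = ennreal (1 - exp (- a))"
  using emeasure_erlang_density[of 1 0 a] assms by (simp add: erlang_CDF_0)

lemma emeasure_std_exponential_greaterThan:
  assumes "0 \<le> a"
  shows "emeasure std_exponential {a<..} = ennreal (exp (- a))"
proof -
  interpret prob_space std_exponential by (rule prob_space_std_exponential)
  have "emeasure std_exponential (space std_exponential - {..a}) = 1 - emeasure std_exponential {..a}"
    using emeasure_compl[of "{..a}" std_exponential] emeasure_space_1 by simp
  also have "space std_exponential - {..a} = {a<..}"
    by auto
  also have "1 - emeasure std_exponential {..a} = ennreal (1 - (1 - exp (- a)))"
    using assms by (simp add: emeasure_std_exponential_atMost ennreal_minus flip: ennreal_1)
  finally show ?thesis by simp
qed

lemma nn_integral_std_exponential: "(\<integral>\<^sup>+t. ennreal t \<partial>std_exponential) = 1"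
proof -
  have "(\<integral>\<^sup>+t. ennreal t \<partial>std_exponential) = (\<integral>\<^sup>+t. ennreal (exponential_density 1 t) * ennreal t \<partial>lborel)"
    by (rule nn_integral_density) auto
  also have "\<dots> = (\<integral>\<^sup>+t. ennreal (exponential_density 1 t * t ^ 1) \<partial>lborel)"
    by (intro nn_integral_cong) (simp add: ennreal_mult' exponential_density_nonneg)
  also have "\<dots> = 1"
    using nn_integral_erlang_ith_moment[of 1 0 1] by simp
  finally show ?thesis .
qed

lemma AE_std_exponential_pos: "AE t in std_exponential. 0 < t"
proof -
  interpret prob_space std_exponential by (rule prob_space_std_exponential)
  have "emeasure std_exponential {..0} = 0"
    by (simp add: emeasure_std_exponential_atMost)
  then have "AE t in std_exponential. t \<notin> {..0}"
    by (intro AE_not_in) (simp add: null_sets_def)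
  then show ?thesis by eventually_elim auto
qed

abbreviation holding_measure :: "(nat \<Rightarrow> real) measure" where
  "holding_measure \<equiv> PiM UNIV (\<lambda>_. std_exponential)"

lemma product_prob_space_std_exponential: "product_prob_space (\<lambda>_::nat. std_exponential)"
proof -
  interpret prob_space std_exponential by (rule prob_space_std_exponential)
  show ?thesis by unfold_locales
qed

lemma prob_space_holding_measure: "prob_space holding_measure"
  by (rule prob_space_PiM) (rule prob_space_std_exponential)

lemma sets_ctmc_measure [measurable_cong]:
  "sets (ctmc_measure rate \<mu>) =
    sets (PiM UNIV (\<lambda>_. count_space UNIV) \<Otimes>\<^sub>M PiM UNIV (\<lambda>_. borel))"
  unfolding ctmc_measure_def
  by (intro sets_pair_measure_cong sets_jump_chain_measure sets_PiM_cong) simp_all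

lemma space_ctmc_measure [simp]: "space (ctmc_measure rate \<mu>) = UNIV"
  using sets_eq_imp_space_eq[OF sets_ctmc_measure, of rate \<mu>] by (simp add: space_PiM space_pair_measure)

lemma prob_space_ctmc_measure: "prob_space (ctmc_measure rate \<mu>)"
proof -
  interpret A: prob_space "jump_chain_measure \<mu> (jump_pmf rate)" by (rule prob_space_jump_chain)
  interpret B: prob_space holding_measure by (rule prob_space_holding_measure)
  interpret pair_prob_space "jump_chain_measure \<mu> (jump_pmf rate)" holding_measure ..
  show ?thesis unfolding ctmc_measure_def by unfold_locales
qed

lemma nn_integral_ctmc_measure_mult:
  assumes [measurable]: "F \<in> borel_measurable (PiM UNIV (\<lambda>_. count_space UNIV))"
    "G \<in> borel_measurable (PiM UNIV (\<lambda>_. borel))"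
  shows "(\<integral>\<^sup>+\<omega>. F (fst \<omega>) * G (snd \<omega>) \<partial>ctmc_measure rate \<mu>) =
    (\<integral>\<^sup>+Y. F Y \<partial>jump_chain_measure \<mu> (jump_pmf rate)) * (\<integral>\<^sup>+E. G E \<partial>holding_measure)"
proof -
  let ?J = "jump_chain_measure \<mu> (jump_pmf rate)"
  interpret prob_space holding_measure by (rule prob_space_holding_measure)
  have F: "F \<in> borel_measurable ?J"
    using assms(1) by (simp cong: measurable_cong_sets)
  have s: "sets holding_measure = sets (PiM UNIV (\<lambda>_. borel))"
    by (intro sets_PiM_cong) simp_all
  have G: "G \<in> borel_measurable holding_measure"
    using assms(2) measurable_cong_sets[OF s refl] by simp
  note [measurable] = F G
  have "(\<integral>\<^sup>+\<omega>. F (fst \<omega>) * G (snd \<omega>) \<partial>ctmc_measure rate \<mu>) = (\<integral>\<^sup>+Y. (\<integral>\<^sup>+E. F Y * G E \<partial>holding_measure) \<partial>?J)"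
    unfolding ctmc_measure_def
    by (subst nn_integral_fst[symmetric]) (simp_all add: case_prod_beta')
  also have "\<dots> = (\<integral>\<^sup>+Y. F Y * (\<integral>\<^sup>+E. G E \<partial>holding_measure) \<partial>?J)"
    using G by (simp add: nn_integral_cmult)
  also have "\<dots> = (\<integral>\<^sup>+Y. F Y \<partial>?J) * (\<integral>\<^sup>+E. G E \<partial>holding_measure)"
    using F by (simp add: nn_integral_multc)
  finally show ?thesis .
qed

lemma nn_integral_ctmc_measure_fst:
  assumes "F \<in> borel_measurable (PiM UNIV (\<lambda>_. count_space UNIV))"
  shows "(\<integral>\<^sup>+\<omega>. F (fst \<omega>) \<partial>ctmc_measure rate \<mu>) = (\<integral>\<^sup>+Y. F Y \<partial>jump_chain_measure \<mu> (jump_pmf rate))"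
  using nn_integral_ctmc_measure_mult[OF assms, of "\<lambda>_. 1" rate \<mu>]
    prob_space.emeasure_space_1[OF prob_space_holding_measure] by simp

lemma nn_integral_holding_time: "(\<integral>\<^sup>+E. ennreal (E i) \<partial>holding_measure) = 1"
proof -
  interpret product_prob_space "\<lambda>_::nat. std_exponential" UNIV
    by (rule product_prob_space_std_exponential)
  have "(\<integral>\<^sup>+t. ennreal t \<partial>std_exponential) = (\<integral>\<^sup>+t. ennreal t \<partial>distr holding_measure std_exponential (\<lambda>\<omega>. \<omega> i))"
    by (subst PiM_component) simp_all
  also have "\<dots> = (\<integral>\<^sup>+E. ennreal (E i) \<partial>holding_measure)"
    by (rule nn_integral_distr) simp_all
  finally show ?thesis
    by (simp add: nn_integral_std_exponential)
qed

lemma AE_ctmc_measure_holding_pos: "AE \<omega> in ctmc_measure rate \<mu>. \<forall>i. 0 < snd \<omega> i"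
proof -
  interpret H: product_prob_space "\<lambda>_::nat. std_exponential" UNIV
    by (rule product_prob_space_std_exponential)
  have "AE E in holding_measure. \<forall>i. 0 < E i"
    unfolding AE_all_countable using H.AE_component[OF UNIV_I AE_std_exponential_pos] by blast
  then have "AE Y in jump_chain_measure \<mu> (jump_pmf rate). AE E in holding_measure. \<forall>i. 0 < snd (Y, E) i"
    by simp
  moreover have "{\<omega> \<in> space (ctmc_measure rate \<mu>). \<forall>i. 0 < snd \<omega> i} \<in> sets (ctmc_measure rate \<mu>)"
    by measurable
  ultimately show ?thesis
    unfolding ctmc_measure_def
    by (intro pair_sigma_finite.AE_pair_measure pair_sigma_finite.intro prob_space_imp_sigma_finite
        prob_space_jump_chain prob_space_holding_measure)
qed

text \<open>Positive transition probabilities and the lower bound for stationary laws are both read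
  off from such rectangles: a prescribed initial piece of the jump chain, with each unscaled holding
  time in a prescribed set. Independence gives the product.\<close>

lemma ctmc_cylinder:
  assumes B: "\<And>i. B i \<in> sets borel"
  shows "{\<omega>. (\<forall>i\<le>k. fst \<omega> i = z i) \<and> (\<forall>i\<le>k. snd \<omega> i \<in> B i)} \<in> sets (ctmc_measure rate \<mu>)" (is "?A \<in> _")
    and "emeasure (ctmc_measure rate \<mu>) {\<omega>. (\<forall>i\<le>k. fst \<omega> i = z i) \<and> (\<forall>i\<le>k. snd \<omega> i \<in> B i)} =
      ennreal (pmf \<mu> (z 0) * (\<Prod>i<k. pmf (jump_pmf rate (z i)) (z (Suc i)))) *
      (\<Prod>i\<le>k. emeasure std_exponential (B i))"
proof -
  interpret product_prob_space "\<lambda>_::nat. std_exponential" UNIV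
    by (rule product_prob_space_std_exponential)
  let ?J = "jump_chain_measure \<mu> (jump_pmf rate)"
  let ?Y = "{Y. \<forall>i\<le>k. Y i = z i}" and ?E = "{E. \<forall>i\<in>{..k}. E i \<in> B i}"
  have "{\<omega> \<in> space (PiM UNIV (\<lambda>_. count_space UNIV)). \<forall>i\<le>k. \<omega> i = z i} \<in>
      sets (PiM UNIV (\<lambda>_. count_space (UNIV :: 'a set)))"
    by measurable
  then have Y: "?Y \<in> sets ?J"
    by (simp add: space_PiM)
  note [measurable] = B
  have "{E \<in> space holding_measure. \<forall>i\<in>{..k}. E i \<in> B i} \<in> sets holding_measure"
    using B by measurable
  then have E: "?E \<in> sets holding_measure"
    by (simp add: space_PiM)
  have A: "?A = ?Y \<times> ?E"
    by auto
  show "?A \<in> sets (ctmc_measure rate \<mu>)"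
    unfolding A ctmc_measure_def using Y E by (rule pair_measureI)
  have "emeasure holding_measure ?E = (\<Prod>i\<le>k. emeasure std_exponential (B i))"
    using emeasure_PiM_Collect[of "{..k}" B] B by (simp add: space_PiM)
  moreover have "emeasure (ctmc_measure rate \<mu>) (?Y \<times> ?E) = emeasure ?J ?Y * emeasure holding_measure ?E"
    unfolding ctmc_measure_def using Y E by (rule P.emeasure_pair_measure_Times)
  ultimately show "emeasure (ctmc_measure rate \<mu>) ?A =
      ennreal (pmf \<mu> (z 0) * (\<Prod>i<k. pmf (jump_pmf rate (z i)) (z (Suc i)))) *
      (\<Prod>i\<le>k. emeasure std_exponential (B i))"
    unfolding A jump_chain_cylinder by simp
qed

lemma jump_time_mono: "i \<le> j \<Longrightarrow> jump_time rate \<omega> i \<le> jump_time rate \<omega> j"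
  unfolding jump_time_def by (intro sum_mono2) auto

lemma ctmc_at_eqI:
  assumes "jump_time rate \<omega> k \<le> ennreal t" "ennreal t < jump_time rate \<omega> (Suc k)"
  shows "ctmc_at rate \<omega> t = Some (fst \<omega> k)"
proof -
  have "(LEAST k. ennreal t < jump_time rate \<omega> (Suc k)) = k"
  proof (rule Least_equality)
    fix j assume "ennreal t < jump_time rate \<omega> (Suc j)"
    then show "k \<le> j"
      using assms(1) jump_time_mono[of "Suc j" k rate \<omega>] by (meson leD leI le_less_trans Suc_leI less_le_trans)
  qed (fact assms(2))
  then show ?thesis
    using assms(2) by (auto simp: ctmc_at_def)
qed

text \<open>The \<open>LEAST\<close> in \<open>ctmc_at\<close> is resolved into a countable union
  over its possible values \<open>k\<close>; each piece involves only finitely many jump times and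
  one coordinate of the jump chain.\<close>

lemma sets_ctmc_at [measurable]: "{\<omega>. ctmc_at rate \<omega> t = Some y} \<in> sets (ctmc_measure rate \<mu>)"
proof -
  let ?M = "ctmc_measure rate \<mu>"
  have f: "(\<lambda>\<omega>. fst \<omega> i) \<in> measurable ?M (count_space UNIV)" for i
    by measurable
  have [measurable]: "(\<lambda>\<omega>. ennreal (exit_rate rate (fst \<omega> i))) \<in> borel_measurable ?M" for i
    by (rule measurable_compose[OF f]) simp
  have [measurable]: "(\<lambda>\<omega>. jump_time rate \<omega> k) \<in> borel_measurable ?M" for k
    unfolding jump_time_def by measurable
  have eq: "{\<omega>. ctmc_at rate \<omega> t = Some y} =
      {\<omega> \<in> space ?M. \<exists>k. (ennreal t < jump_time rate \<omega> (Suc k) \<and>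
        (\<forall>j<k. \<not> ennreal t < jump_time rate \<omega> (Suc j))) \<and> fst \<omega> k = y}" (is "_ = ?B")
  proof (intro set_eqI iffI)
    fix \<omega> assume "\<omega> \<in> {\<omega>. ctmc_at rate \<omega> t = Some y}"
    then have ex: "\<exists>k. ennreal t < jump_time rate \<omega> (Suc k)"
      and y: "fst \<omega> (LEAST k. ennreal t < jump_time rate \<omega> (Suc k)) = y"
      by (auto simp: ctmc_at_def split: if_splits)
    from ex have "ennreal t < jump_time rate \<omega> (Suc (LEAST k. ennreal t < jump_time rate \<omega> (Suc k)))"
      by (rule LeastI_ex)
    moreover have "\<forall>j<(LEAST k. ennreal t < jump_time rate \<omega> (Suc k)). \<not> ennreal t < jump_time rate \<omega> (Suc j)"
      by (intro allI impI) (rule not_less_Least)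
    ultimately show "\<omega> \<in> ?B"
      using y by (simp only: space_ctmc_measure mem_Collect_eq UNIV_I simp_thms) (rule exI, intro conjI)
  next
    fix \<omega> assume "\<omega> \<in> ?B"
    then obtain k where k: "ennreal t < jump_time rate \<omega> (Suc k)"
      "\<forall>j<k. \<not> ennreal t < jump_time rate \<omega> (Suc j)" "fst \<omega> k = y"
      by blast
    have "(LEAST k. ennreal t < jump_time rate \<omega> (Suc k)) = k"
      using k(1,2) by (intro Least_equality) (blast intro: leI)+
    then show "\<omega> \<in> {\<omega>. ctmc_at rate \<omega> t = Some y}"
      using k unfolding ctmc_at_def by (simp only: mem_Collect_eq) (simp, blast)
  qed
  have [measurable]: "Measurable.pred ?M (\<lambda>\<omega>. fst \<omega> k = y)" for k
    using f[of k] by (rule measurable_compose) simp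
  show ?thesis
    unfolding eq by measurable
qed

section \<open>Chains with bounded rates\<close>

text \<open>Finite rows let the rates act on arbitrary real functions by finite sums, with no growth
  condition. Finite columns do the same for the inflow into a state.\<close>

locale finite_rates =
  fixes rate :: "'s \<Rightarrow> 's \<Rightarrow> real"
  assumes rate_nonneg [simp]: "0 \<le> rate x y"
    and rate_finite: "finite {y. rate x y \<noteq> 0}"
    and column_finite: "finite {x. rate x y \<noteq> 0}"
    and rate_diag [simp]: "rate x x = 0"
begin

definition nbrs :: "'s \<Rightarrow> 's set" where
  "nbrs x = {y. rate x y \<noteq> 0}"

text \<open>The gain part of the generator; the full generator is
  \<open>flow f x - exit_rate rate x * f x\<close>. Gain and loss are kept apart so that both can be
  integrated as nonnegative functions.\<close>

definition flow :: "('s \<Rightarrow> real) \<Rightarrow> 's \<Rightarrow> real" where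
  "flow f x = (\<Sum>y\<in>nbrs x. rate x y * f y)"

abbreviation "edges \<equiv> {(x, y). 0 < rate x y}"

lemma finite_nbrs [simp]: "finite (nbrs x)"
  using rate_finite by (simp add: nbrs_def)

lemma rate_pos_iff: "0 < rate x y \<longleftrightarrow> y \<in> nbrs x"
  using rate_nonneg[of x y] by (auto simp: nbrs_def less_le simp del: rate_nonneg)

lemma flow_superset:
  assumes "finite A" "nbrs x \<subseteq> A"
  shows "flow f x = (\<Sum>y\<in>A. rate x y * f y)"
  unfolding flow_def using assms by (intro sum.mono_neutral_left) (auto simp: nbrs_def)

lemma exit_rate_eq: "exit_rate rate x = (\<Sum>y\<in>nbrs x. rate x y)"
proof -
  have "exit_rate rate x = infsum (rate x) (nbrs x)"
    unfolding exit_rate_def by (rule infsum_cong_neutral) (auto simp: nbrs_def)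
  then show ?thesis by simp
qed

lemma flow_const: "flow (\<lambda>_. c) x = exit_rate rate x * c"
  by (simp add: flow_def exit_rate_eq sum_distrib_right)

lemma flow_add: "flow (\<lambda>y. f y + g y) x = flow f x + flow g x"
  by (simp add: flow_def sum.distrib algebra_simps)

lemma flow_diff: "flow (\<lambda>y. f y - g y) x = flow f x - flow g x"
  by (simp add: flow_def sum_subtractf algebra_simps)

lemma flow_cmult: "flow (\<lambda>y. c * f y) x = c * flow f x"
  by (simp add: flow_def sum_distrib_left algebra_simps)

lemma flow_sum: "flow (\<lambda>y. \<Sum>i\<in>I. f i y) x = (\<Sum>i\<in>I. flow (f i) x)"
  unfolding flow_def sum_distrib_left by (rule sum.swap)

lemma flow_mono: "(\<And>y. y \<in> nbrs x \<Longrightarrow> f y \<le> g y) \<Longrightarrow> flow f x \<le> flow g x"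
  unfolding flow_def by (intro sum_mono mult_left_mono) auto

end

text \<open>The lower bound makes every mean holding time at most \<open>1 / l\<close>, so counting
  jumps controls time. The upper bound makes the mean outflow of a bounded function finite, so that
  it can be cancelled.\<close>

locale bounded_rates = finite_rates rate for rate :: "'s \<Rightarrow> 's \<Rightarrow> real" +
  fixes l u :: real
  assumes l_pos: "0 < l"
    and exit_ge: "l \<le> exit_rate rate x"
    and exit_le: "exit_rate rate x \<le> u"
begin

lemma exit_pos: "0 < exit_rate rate x"
  using l_pos exit_ge[of x] by linarith

lemma u_pos: "0 < u"
  using exit_pos exit_le less_le_trans by blast

lemma pmf_jump: "pmf (jump_pmf rate x) y = rate x y / exit_rate rate x"
  using pmf_jump_pmf[of rate x y] rate_finite exit_pos[of x] by auto

lemma nn_integral_jump_pmf: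
  "(\<integral>\<^sup>+y. f y \<partial>jump_pmf rate x) = (\<Sum>y\<in>nbrs x. ennreal (rate x y / exit_rate rate x) * f y)"
proof -
  have "set_pmf (jump_pmf rate x) \<subseteq> nbrs x"
    by (auto simp: set_pmf_eq pmf_jump nbrs_def)
  then have "(\<integral>\<^sup>+y. f y \<partial>jump_pmf rate x) = (\<Sum>y\<in>nbrs x. f y * ennreal (pmf (jump_pmf rate x) y))"
    by (intro nn_integral_measure_pmf_support) auto
  then show ?thesis
    by (simp add: pmf_jump mult.commute)
qed

lemma nn_integral_jump_pmf_real:
  assumes "\<And>y. y \<in> nbrs x \<Longrightarrow> 0 \<le> f y"
  shows "(\<integral>\<^sup>+y. ennreal (f y) \<partial>jump_pmf rate x) = ennreal (flow f x / exit_rate rate x)"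
proof -
  have "(\<integral>\<^sup>+y. ennreal (f y) \<partial>jump_pmf rate x) =
      (\<Sum>y\<in>nbrs x. ennreal (rate x y / exit_rate rate x * f y))"
    unfolding nn_integral_jump_pmf using exit_pos[of x] assms
    by (intro sum.cong refl ennreal_mult[symmetric]) (auto simp: less_imp_le)
  also have "\<dots> = ennreal (\<Sum>y\<in>nbrs x. rate x y / exit_rate rate x * f y)"
    using exit_pos[of x] assms by (intro sum_ennreal) (simp add: less_imp_le)
  also have "(\<Sum>y\<in>nbrs x. rate x y / exit_rate rate x * f y) = flow f x / exit_rate rate x"
    by (simp add: flow_def sum_divide_distrib)
  finally show ?thesis .
qed

lemma holding_eq: "ennreal a / ennreal (exit_rate rate x) = ennreal (a / exit_rate rate x)"
proof (cases "0 \<le> a")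
  case True
  then show ?thesis by (simp add: divide_ennreal exit_pos)
next
  case False
  then have "a / exit_rate rate x \<le> 0"
    using exit_pos[of x] by (simp add: divide_nonpos_pos)
  with False show ?thesis by (simp add: ennreal_neg)
qed

lemma jump_time_eq: "jump_time rate \<omega> k = (\<Sum>i<k. ennreal (snd \<omega> i / exit_rate rate (fst \<omega> i)))"
  by (simp add: jump_time_def holding_eq)

subsection \<open>Irreducibility\<close>

text \<open>Along a path of \<open>k\<close> edges from \<open>x\<close> to \<open>y\<close>, it
  suffices that the first \<open>k\<close> holding times are short enough to end before time 1 and
  the next one is longer than 1.\<close>

lemma ctmc_at_pos:
  assumes "(x, y) \<in> edges\<^sup>*"
  shows "\<P>(\<omega> in ctmc_measure rate (return_pmf x). ctmc_at rate \<omega> 1 = Some y) > 0"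
proof -
  interpret P: prob_space "ctmc_measure rate (return_pmf x)"
    by (rule prob_space_ctmc_measure)
  obtain k where "(x, y) \<in> edges ^^ k"
    using assms rtrancl_imp_relpow by blast
  then obtain z where z: "z 0 = x" "z k = y" "\<And>i. i < k \<Longrightarrow> 0 < rate (z i) (z (Suc i))"
    unfolding relpow_fun_conv by auto
  \<comment> \<open>Since exit rates lie in [\<open>l\<close>, \<open>u\<close>], the first
    \<open>k\<close> holding times are at most \<open>1 / (k + 1)\<close> each, with sum at most 1,
    and the one in \<open>y\<close> exceeds 1 by itself.\<close>
  define B where "B i = (if i < k then {..l / real (k + 1)} else {u<..})" for i
  let ?A = "{\<omega>. (\<forall>i\<le>k. fst \<omega> i = z i) \<and> (\<forall>i\<le>k. snd \<omega> i \<in> B i)}"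
  have B: "B i \<in> sets borel" for i
    by (auto simp: B_def)
  have sub: "?A \<subseteq> {\<omega>. ctmc_at rate \<omega> 1 = Some y}"
  proof
    fix \<omega> assume A: "\<omega> \<in> ?A"
    have "jump_time rate \<omega> k = (\<Sum>i<k. ennreal (snd \<omega> i / exit_rate rate (fst \<omega> i)))"
      by (rule jump_time_eq)
    also have "\<dots> \<le> (\<Sum>i<k. ennreal (1 / real (k + 1)))"
    proof (intro sum_mono ennreal_leI)
      fix i assume i: "i \<in> {..<k}"
      then have "snd \<omega> i \<in> B i"
        using A by auto
      with i have "snd \<omega> i \<le> l / real (k + 1)"
        by (simp add: B_def)
      also have "\<dots> \<le> exit_rate rate (fst \<omega> i) / real (k + 1)"
        using exit_ge by (intro divide_right_mono) auto
      finally show "snd \<omega> i / exit_rate rate (fst \<omega> i) \<le> 1 / real (k + 1)"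
        using exit_pos[of "fst \<omega> i"] by (simp add: field_simps)
    qed
    also have "\<dots> = ennreal (\<Sum>i<k. 1 / real (k + 1))"
      by (intro sum_ennreal) simp
    also have "\<dots> \<le> ennreal 1"
      by (intro ennreal_leI) simp
    finally have le: "jump_time rate \<omega> k \<le> ennreal 1" .
    have "snd \<omega> k \<in> B k"
      using A by auto
    then have "u < snd \<omega> k"
      by (simp add: B_def)
    then have "1 < snd \<omega> k / exit_rate rate (fst \<omega> k)"
      using exit_pos[of "fst \<omega> k"] exit_le[of "fst \<omega> k"] by (simp add: field_simps)
    then have "ennreal 1 < ennreal (snd \<omega> k / exit_rate rate (fst \<omega> k))"
      by (subst ennreal_less_iff) auto
    also have "\<dots> \<le> jump_time rate \<omega> (Suc k)"
      by (simp add: jump_time_eq)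
    finally have "ctmc_at rate \<omega> 1 = Some (fst \<omega> k)"
      using le by (intro ctmc_at_eqI)
    then show "\<omega> \<in> {\<omega>. ctmc_at rate \<omega> 1 = Some y}"
      using A z by auto
  qed
  have "emeasure (ctmc_measure rate (return_pmf x)) ?A \<noteq> 0"
  proof -
    have "0 < (\<Prod>i<k. pmf (jump_pmf rate (z i)) (z (Suc i)))"
      using z(3) exit_pos by (intro prod_pos) (simp add: pmf_jump)
    then have "0 < pmf (return_pmf x) (z 0) * (\<Prod>i<k. pmf (jump_pmf rate (z i)) (z (Suc i)))"
      using z(1) by simp
    then have "ennreal (pmf (return_pmf x) (z 0) * (\<Prod>i<k. pmf (jump_pmf rate (z i)) (z (Suc i)))) \<noteq> 0"
      by (simp only: ennreal_eq_0_iff not_le)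
    moreover have "(\<Prod>i\<le>k. emeasure std_exponential (B i)) \<noteq> 0"
    proof -
      have "emeasure std_exponential (B i) \<noteq> 0" for i
        using l_pos u_pos by (auto simp: B_def emeasure_std_exponential_atMost emeasure_std_exponential_greaterThan)
      then show ?thesis by simp
    qed
    ultimately show ?thesis
      unfolding ctmc_cylinder(2)[where B = B and k = k and z = z, OF B] by (intro no_zero_divisors)
  qed
  then have "0 < measure (ctmc_measure rate (return_pmf x)) ?A"
    by (simp add: P.emeasure_eq_measure less_le)
  also have "\<dots> \<le> measure (ctmc_measure rate (return_pmf x)) {\<omega>. ctmc_at rate \<omega> 1 = Some y}"
    by (intro P.finite_measure_mono sub sets_ctmc_at)
  finally show ?thesis by simp
qed

lemma irreducible_ctmcI:
  assumes "\<And>x y. x \<in> S \<Longrightarrow> y \<in> S \<Longrightarrow> (x, y) \<in> edges\<^sup>*"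
  shows "irreducible_ctmc S rate"
  unfolding irreducible_ctmc_def using ctmc_at_pos assms zero_le_one by blast

subsection \<open>Stationary distributions are excessive\<close>

text \<open>
  Only trajectories with at most one jump before time \<open>t\<close> are used. This gives one half of the
  balance equations; the other half follows by summation, since the exit rates are bounded.
\<close>

lemma stationary_lower_bound:
  assumes st: "stationary_distribution S rate \<pi>" and y: "y \<in> S" and t: "0 < t"
    and A: "finite A" "y \<notin> A"
  shows "pmf \<pi> y * exp (- exit_rate rate y * t) +
      (\<Sum>x\<in>A. pmf \<pi> x * (rate x y / exit_rate rate x) *
        (1 - exp (- exit_rate rate x * t)) * exp (- exit_rate rate y * t)) \<le> pmf \<pi> y"
proof -
  let ?M = "ctmc_measure rate \<pi>" and ?e = "exit_rate rate"
  interpret P: prob_space ?M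
    by (rule prob_space_ctmc_measure)
  define z where "z x i = (if i = (0::nat) then x else y)" for x i
  \<comment> \<open>The coordinates of \<open>snd \<omega>\<close> are unscaled, hence the factors
    \<open>?e\<close>. The second holding time is required to exceed all of \<open>t\<close> and not
    only the remainder after the jump; this makes \<open>C x\<close> a rectangle and costs a factor
    that tends to 1 as \<open>t\<close> tends to 0.\<close>
  define B where "B x i = (if i = (0::nat) then {..?e x * t} else {?e y * t<..})" for x i
  define C0 :: "((nat \<Rightarrow> 's) \<times> (nat \<Rightarrow> real)) set" where "C0 = {\<omega>. (\<forall>i\<le>0. fst \<omega> i = y) \<and> (\<forall>i\<le>0. snd \<omega> i \<in> {?e y * t<..})}"
  define C :: "'s \<Rightarrow> ((nat \<Rightarrow> 's) \<times> (nat \<Rightarrow> real)) set" where "C x = {\<omega>. (\<forall>i\<le>1. fst \<omega> i = z x i) \<and> (\<forall>i\<le>1. snd \<omega> i \<in> B x i)}" for x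
  have B: "B x i \<in> sets borel" for x i
    by (auto simp: B_def)
  have et: "0 \<le> ?e x * t" for x
    using t exit_pos[of x] by simp
  have C0: "C0 \<in> sets ?M" "measure ?M C0 = pmf \<pi> y * exp (- ?e y * t)"
  proof -
    show "C0 \<in> sets ?M"
      unfolding C0_def by (rule ctmc_cylinder(1)) simp
    have "emeasure ?M C0 = ennreal (pmf \<pi> y * exp (- ?e y * t))"
      unfolding C0_def using ctmc_cylinder(2)[where B = "\<lambda>_. {?e y * t<..}" and k = 0 and z = "\<lambda>_. y" and rate = rate and \<mu> = \<pi>] et[of y]
      by (simp add: emeasure_std_exponential_greaterThan ennreal_mult)
    then show "measure ?M C0 = pmf \<pi> y * exp (- ?e y * t)"
      by (simp add: P.emeasure_eq_measure)
  qed
  have C: "C x \<in> sets ?M"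
    "measure ?M (C x) = pmf \<pi> x * (rate x y / ?e x) * (1 - exp (- ?e x * t)) * exp (- ?e y * t)" for x
  proof -
    show "C x \<in> sets ?M"
      unfolding C_def by (rule ctmc_cylinder(1)) (rule B)
    have "emeasure ?M (C x) = ennreal (pmf \<pi> x * (rate x y / ?e x)) *
        (ennreal (1 - exp (- (?e x * t))) * ennreal (exp (- (?e y * t))))"
      unfolding C_def ctmc_cylinder(2)[where B = "B x" and k = 1 and z = "z x", OF B] using et[of x] et[of y]
      by (simp add: z_def B_def pmf_jump emeasure_std_exponential_atMost emeasure_std_exponential_greaterThan)
    also have "\<dots> = ennreal (pmf \<pi> x * (rate x y / ?e x) * ((1 - exp (- (?e x * t))) * exp (- (?e y * t))))"
    proof -
      have "0 \<le> pmf \<pi> x * (rate x y / ?e x)" "0 \<le> 1 - exp (- (?e x * t))"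
        using et[of x] exit_pos[of x] by (simp_all add: less_imp_le)
      then show ?thesis
        by (simp only: ennreal_mult mult_nonneg_nonneg exp_ge_zero)
    qed
    finally show "measure ?M (C x) = pmf \<pi> x * (rate x y / ?e x) * (1 - exp (- ?e x * t)) * exp (- ?e y * t)"
      using et[of x] exit_pos[of x] by (simp add: P.emeasure_eq_measure mult.assoc less_imp_le)
  qed
  have sub: "C0 \<union> (\<Union>x\<in>A. C x) \<subseteq> {\<omega>. ctmc_at rate \<omega> t = Some y}"
  proof
    fix \<omega> assume "\<omega> \<in> C0 \<union> (\<Union>x\<in>A. C x)"
    then consider "\<omega> \<in> C0" | x where "\<omega> \<in> C x" by auto
    then show "\<omega> \<in> {\<omega>. ctmc_at rate \<omega> t = Some y}"
    proof cases
      case 1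
      then have "fst \<omega> 0 = y" "t < snd \<omega> 0 / ?e (fst \<omega> 0)"
        using exit_pos[of y] by (auto simp: C0_def field_simps)
      then have "ctmc_at rate \<omega> t = Some (fst \<omega> 0)"
        using t by (intro ctmc_at_eqI) (simp_all add: jump_time_eq ennreal_less_iff)
      then show ?thesis
        using \<open>fst \<omega> 0 = y\<close> by simp
    next
      case 2
      then have "\<forall>i\<le>1. fst \<omega> i = z x i" "\<forall>i\<le>1. snd \<omega> i \<in> B x i"
        by (simp_all add: C_def)
      then have f: "fst \<omega> 0 = x" "fst \<omega> 1 = y" and s: "snd \<omega> 0 \<le> ?e x * t" "?e y * t < snd \<omega> 1"
        by (auto simp: z_def B_def dest: spec[of _ 0] spec[of _ 1])
      then have "snd \<omega> 0 / ?e (fst \<omega> 0) \<le> t" "t < snd \<omega> 1 / ?e (fst \<omega> 1)"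
        using exit_pos[of y] exit_pos[of x] by (auto simp: field_simps)
      then have "ennreal (snd \<omega> 0 / ?e (fst \<omega> 0)) \<le> ennreal t" "ennreal t < ennreal (snd \<omega> 1 / ?e (fst \<omega> 1))"
        using t by (auto simp: ennreal_less_iff intro: ennreal_leI)
      then have "ctmc_at rate \<omega> t = Some (fst \<omega> 1)"
        by (intro ctmc_at_eqI) (auto simp: jump_time_eq intro: less_le_trans)
      then show ?thesis
        using f by simp
    qed
  qed
  have disj: "disjoint_family_on C A"
    by (auto simp: disjoint_family_on_def C_def z_def dest: spec[of _ 0])
  have "C0 \<inter> (\<Union>x\<in>A. C x) = {}"
    using A(2) by (auto simp: C0_def C_def z_def dest: spec[of _ 0])
  then have "measure ?M (C0 \<union> (\<Union>x\<in>A. C x)) = measure ?M C0 + measure ?M (\<Union>x\<in>A. C x)"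
    using C0 C A by (intro P.finite_measure_Union) auto
  also have "measure ?M (\<Union>x\<in>A. C x) = (\<Sum>x\<in>A. measure ?M (C x))"
    using A C disj by (intro P.finite_measure_finite_Union) auto
  finally have "measure ?M C0 + (\<Sum>x\<in>A. measure ?M (C x)) = measure ?M (C0 \<union> (\<Union>x\<in>A. C x))"
    by simp
  also have "\<dots> \<le> measure ?M {\<omega>. ctmc_at rate \<omega> t = Some y}"
    by (intro P.finite_measure_mono sub sets_ctmc_at)
  also have "\<dots> = pmf \<pi> y"
    using st y t by (simp add: stationary_distribution_def)
  finally show ?thesis
    unfolding C0(2) C(2) .
qed

text \<open>Subinvariance of \<open>\<pi>\<close> for the generator, that is, global balance
  weakened to an inequality. It is preserved by pointwise minima of the weights, which equality is
  not evidently.\<close>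

definition excessive :: "'s set \<Rightarrow> 's pmf \<Rightarrow> bool" where
  "excessive S \<pi> \<longleftrightarrow> set_pmf \<pi> \<subseteq> S \<and>
    (\<forall>y\<in>S. (\<integral>\<^sup>+x. ennreal (rate x y) \<partial>\<pi>) \<le> ennreal (exit_rate rate y * pmf \<pi> y))"

text \<open>Move the first term of the short-time bound to the right, divide by \<open>t\<close> and
  let \<open>t\<close> tend to 0 from above: (1 - exp (- c t)) / t tends to c, the derivative at 0,
  and the remaining exponential tends to 1.\<close>

lemma stationary_finite_balance:
  assumes st: "stationary_distribution S rate \<pi>" and y: "y \<in> S" and A: "finite A" "y \<notin> A"
  shows "(\<Sum>x\<in>A. pmf \<pi> x * rate x y) \<le> exit_rate rate y * pmf \<pi> y"
proof -
  let ?e = "exit_rate rate"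
  have lim: "((\<lambda>t. (1 - exp (- c * t)) / t) \<longlongrightarrow> c) (at_right 0)" for c :: real
  proof -
    have "((\<lambda>t. 1 - exp (- c * t)) has_real_derivative c) (at_right 0)"
      by (auto intro!: derivative_eq_intros)
    then show ?thesis
      by (simp add: has_field_derivative_iff)
  qed
  have "((\<lambda>t. \<Sum>x\<in>A. pmf \<pi> x * (rate x y / ?e x) * ((1 - exp (- ?e x * t)) / t) * exp (- ?e y * t))
      \<longlongrightarrow> (\<Sum>x\<in>A. pmf \<pi> x * (rate x y / ?e x) * ?e x * exp (- ?e y * 0))) (at_right 0)"
    by (intro tendsto_intros lim)
  moreover have "((\<lambda>t. pmf \<pi> y * ((1 - exp (- ?e y * t)) / t)) \<longlongrightarrow> pmf \<pi> y * ?e y) (at_right 0)"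
    by (intro tendsto_intros lim)
  moreover have "eventually (\<lambda>t. (\<Sum>x\<in>A. pmf \<pi> x * (rate x y / ?e x) * ((1 - exp (- ?e x * t)) / t) * exp (- ?e y * t))
      \<le> pmf \<pi> y * ((1 - exp (- ?e y * t)) / t)) (at_right 0)"
    unfolding eventually_at_right_field
  proof (intro exI[of _ 1] conjI allI impI)
    fix t :: real assume t: "0 < t"
    have "(\<Sum>x\<in>A. pmf \<pi> x * (rate x y / ?e x) * ((1 - exp (- ?e x * t)) / t) * exp (- ?e y * t)) =
        (\<Sum>x\<in>A. pmf \<pi> x * (rate x y / ?e x) * (1 - exp (- ?e x * t)) * exp (- ?e y * t)) / t"
      unfolding sum_divide_distrib by (intro sum.cong) auto
    also have "\<dots> \<le> (pmf \<pi> y * (1 - exp (- ?e y * t))) / t"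
      using stationary_lower_bound[OF st y t A] t by (intro divide_right_mono) (simp_all add: algebra_simps)
    finally show "(\<Sum>x\<in>A. pmf \<pi> x * (rate x y / ?e x) * ((1 - exp (- ?e x * t)) / t) * exp (- ?e y * t))
      \<le> pmf \<pi> y * ((1 - exp (- ?e y * t)) / t)" by simp
  qed simp
  ultimately have "(\<Sum>x\<in>A. pmf \<pi> x * (rate x y / ?e x) * ?e x * exp (- ?e y * 0)) \<le> pmf \<pi> y * ?e y"
    by (intro tendsto_le[OF trivial_limit_at_right_real]) 
  moreover have "pmf \<pi> x * (rate x y / ?e x) * ?e x = pmf \<pi> x * rate x y" for x
    using exit_pos[of x] by simp
  ultimately show ?thesis
    by (simp add: mult.commute)
qed

lemma stationary_imp_excessive:
  assumes st: "stationary_distribution S rate \<pi>"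
  shows "excessive S \<pi>"
  unfolding excessive_def
proof (intro conjI ballI)
  show "set_pmf \<pi> \<subseteq> S"
    using st by (simp add: stationary_distribution_def)
  fix y assume y: "y \<in> S"
  have "(\<integral>\<^sup>+x. ennreal (rate x y) \<partial>\<pi>) = (\<Sum>x | rate x y \<noteq> 0. ennreal (rate x y) * ennreal (pmf \<pi> x))"
    using column_finite by (intro nn_integral_measure_pmf_support) auto
  also have "\<dots> = ennreal (\<Sum>x | rate x y \<noteq> 0. pmf \<pi> x * rate x y)"
    by (simp add: sum_ennreal mult.commute flip: ennreal_mult)
  \<comment> \<open>The finite set is the whole column of \<open>y\<close>; it does not contain
    \<open>y\<close> because the diagonal rates vanish.\<close>
  also have "\<dots> \<le> ennreal (exit_rate rate y * pmf \<pi> y)"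
    using column_finite by (intro ennreal_leI stationary_finite_balance[OF st y]) auto
  finally show "(\<integral>\<^sup>+x. ennreal (rate x y) \<partial>\<pi>) \<le> ennreal (exit_rate rate y * pmf \<pi> y)" .
qed

end

section \<open>Positive recurrence\<close>

context bounded_rates
begin

text \<open>Index 0 is exempt because the chain starts in \<open>x\<close> itself and only a return
  counts.\<close>

definition avoid :: "'s \<Rightarrow> nat \<Rightarrow> 's \<Rightarrow> ennreal" where
  "avoid x j y = (if j = 0 then 1 else indicator (- {x}) y)"

definition avoids :: "'s \<Rightarrow> nat \<Rightarrow> (nat \<Rightarrow> 's) \<Rightarrow> ennreal" where
  "avoids x k Y = (\<Prod>j\<le>k. avoid x j (Y j))"

text \<open>First-step analysis of the probability, from \<open>y\<close>, of missing
  \<open>x\<close> at steps 1 to \<open>k\<close>. From \<open>y = x\<close> the sum over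
  \<open>k\<close> is the mean number of jumps until the return, by the tail formula for
  expectations.\<close>

primrec avoid_prob :: "'s \<Rightarrow> nat \<Rightarrow> 's \<Rightarrow> ennreal" where
  "avoid_prob x 0 y = 1"
| "avoid_prob x (Suc k) y = (\<integral>\<^sup>+z. indicator (- {x}) z * avoid_prob x k z \<partial>jump_pmf rate y)"

lemma measurable_avoids [measurable]: "avoids x k \<in> borel_measurable (PiM UNIV (\<lambda>_. count_space UNIV))"
  unfolding avoids_def[abs_def] by (intro borel_measurable_prod_ennreal measurable_coordinate) simp

lemma avoids_eq: "avoids x k Y = of_bool (\<forall>j\<in>{1..k}. Y j \<noteq> x)"
proof (induction k)
  case 0
  then show ?case by (simp add: avoids_def avoid_def)
next
  case (Suc k)
  have "avoids x (Suc k) Y = avoids x k Y * avoid x (Suc k) (Y (Suc k))"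
    by (simp add: avoids_def)
  then show ?case
    by (auto simp: Suc avoid_def atLeastAtMostSuc_conv)
qed

lemma nn_integral_avoids:
  "(\<integral>\<^sup>+Y. avoids x k Y \<partial>jump_chain_measure (return_pmf x) (jump_pmf rate)) = avoid_prob x k x"
proof -
  let ?M = "jump_chain_measure (return_pmf x) (jump_pmf rate)"
  \<comment> \<open>Interpolation between the two sides: \<open>k\<close> steps are read off the
    trajectory and \<open>i\<close> further steps are already integrated out. The Markov property
    moves one step across.\<close>
  have "(\<integral>\<^sup>+Y. avoids x k Y * avoid_prob x i (Y k) \<partial>?M) = (\<integral>\<^sup>+Y. avoids x (k + i) Y \<partial>?M)" for k i
  proof (induction i arbitrary: k)
    case (Suc i)
    have "(\<integral>\<^sup>+Y. avoids x k Y * avoid_prob x (Suc i) (Y k) \<partial>?M) =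
        (\<integral>\<^sup>+Y. avoids x k Y * (indicator (- {x}) (Y (Suc k)) * avoid_prob x i (Y (Suc k))) \<partial>?M)"
      unfolding avoids_def avoid_prob.simps
      by (rule nn_integral_jump_chain_Suc[symmetric])
    also have "\<dots> = (\<integral>\<^sup>+Y. avoids x (Suc k) Y * avoid_prob x i (Y (Suc k)) \<partial>?M)"
      by (simp add: avoids_def avoid_def mult.assoc)
    also have "\<dots> = (\<integral>\<^sup>+Y. avoids x (Suc k + i) Y \<partial>?M)"
      by (rule Suc.IH)
    finally show ?case by simp
  qed simp
  from this[of 0 k] have "(\<integral>\<^sup>+Y. avoids x k Y \<partial>?M) = (\<integral>\<^sup>+Y. avoid_prob x k (Y 0) \<partial>?M)"
    by (simp add: avoids_def avoid_def)
  then show ?thesis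
    by (simp add: nn_integral_jump_chain_0[where f = "avoid_prob x k"] nn_integral_return)
qed

text \<open>The total holding time before the first return, written as a series over all indices so
  that it can be integrated term by term.\<close>

definition cycle_time :: "'s \<Rightarrow> (nat \<Rightarrow> 's) \<times> (nat \<Rightarrow> real) \<Rightarrow> ennreal" where
  "cycle_time x \<omega> = (\<Sum>i. avoids x i (fst \<omega>) * ennreal (snd \<omega> i / exit_rate rate (fst \<omega> i)))"

text \<open>With \<open>k\<close> the first return index, the \<open>k\<close>-th jump time belongs
  to the set whose infimum is the return time. Positivity of the holding time at \<open>k\<close> is
  what makes the chain sit in \<open>x\<close> at that very instant.\<close>

lemma return_time_le_cycle_time:
  assumes pos: "\<And>i. 0 < snd \<omega> i" and ret: "\<exists>k\<ge>1. fst \<omega> k = x"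
  shows "return_time rate x \<omega> \<le> cycle_time x \<omega>"
proof -
  define k where "k = (LEAST k. 1 \<le> k \<and> fst \<omega> k = x)"
  have k: "1 \<le> k" "fst \<omega> k = x"
    using LeastI_ex[of "\<lambda>k. 1 \<le> k \<and> fst \<omega> k = x"] ret by (auto simp: k_def)
  have first: "fst \<omega> j \<noteq> x" if "1 \<le> j" "j < k" for j
    using not_less_Least[of j "\<lambda>k. 1 \<le> k \<and> fst \<omega> k = x"] that by (auto simp: k_def)
  define h where "h i = snd \<omega> i / exit_rate rate (fst \<omega> i)" for i
  have h: "0 < h i" for i
    using pos exit_pos by (simp add: h_def)
  define t where "t = (\<Sum>i<k. h i)"
  have t0: "0 \<le> t"
    using h by (auto simp: t_def intro: sum_nonneg less_imp_le)
  have jt: "jump_time rate \<omega> k = ennreal t"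
    using h by (simp add: jump_time_eq t_def flip: h_def) (subst sum_ennreal; simp add: less_imp_le)
  have "jump_time rate \<omega> (Suc k) = ennreal t + ennreal (h k)"
    using jt by (simp add: jump_time_eq flip: h_def)
  also have "\<dots> = ennreal (t + h k)"
    using t0 h[of k] by (simp add: less_imp_le)
  finally have "ennreal t < jump_time rate \<omega> (Suc k)"
    using t0 h[of k] by (simp add: ennreal_less_iff)
  then have at: "ctmc_at rate \<omega> t = Some x"
    using ctmc_at_eqI[of rate \<omega> k t] jt k(2) by simp
  have "jump_time rate \<omega> 1 \<le> ennreal t"
    using jump_time_mono[of 1 k rate \<omega>] k jt by simp
  then have "return_time rate x \<omega> \<le> ennreal t"
    unfolding return_time_def using at t0 by (intro Inf_lower) blast
  also have "\<dots> = (\<Sum>i<k. avoids x i (fst \<omega>) * ennreal (h i))"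
    unfolding jt[symmetric] jump_time_eq h_def[symmetric]
    using first by (intro sum.cong) (auto simp: avoids_eq)
  also have "\<dots> \<le> cycle_time x \<omega>"
    unfolding cycle_time_def h_def by (intro sum_le_suminf) auto
  finally show ?thesis .
qed

text \<open>A holding time depends on the chain through the exit rate. Replacing this rate by
  \<open>l\<close> decouples the two, and each term factors by independence.\<close>

lemma nn_integral_cycle_time:
  "(\<integral>\<^sup>+\<omega>. cycle_time x \<omega> \<partial>ctmc_measure rate (return_pmf x)) \<le> (\<Sum>i. avoid_prob x i x) * ennreal (1 / l)"
proof -
  let ?M = "ctmc_measure rate (return_pmf x)"
  have "(\<integral>\<^sup>+\<omega>. cycle_time x \<omega> \<partial>?M) \<le> (\<integral>\<^sup>+\<omega>. (\<Sum>i. avoids x i (fst \<omega>) * ennreal (snd \<omega> i / l)) \<partial>?M)"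
  proof (intro nn_integral_mono)
    fix \<omega> :: "(nat \<Rightarrow> 's) \<times> (nat \<Rightarrow> real)"
    have "ennreal (snd \<omega> i / exit_rate rate (fst \<omega> i)) \<le> ennreal (snd \<omega> i / l)" for i
    proof (cases "0 \<le> snd \<omega> i")
      case True
      then show ?thesis
        using l_pos exit_ge by (intro ennreal_leI divide_left_mono) (auto intro: mult_pos_pos exit_pos)
    next
      case False
      then show ?thesis
        using exit_pos[of "fst \<omega> i"] by (simp add: ennreal_neg divide_nonpos_pos)
    qed
    then show "cycle_time x \<omega> \<le> (\<Sum>i. avoids x i (fst \<omega>) * ennreal (snd \<omega> i / l))"
      unfolding cycle_time_def by (intro suminf_le mult_left_mono) auto
  qed
  also have "\<dots> = (\<Sum>i. \<integral>\<^sup>+\<omega>. avoids x i (fst \<omega>) * ennreal (snd \<omega> i / l) \<partial>?M)"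
    by (intro nn_integral_suminf) measurable
  also have "\<dots> = (\<Sum>i. avoid_prob x i x * ennreal (1 / l))"
  proof (intro suminf_cong)
    fix i
    have "(\<integral>\<^sup>+\<omega>. avoids x i (fst \<omega>) * ennreal (snd \<omega> i / l) \<partial>?M) =
        avoid_prob x i x * (\<integral>\<^sup>+E. ennreal (E i / l) \<partial>holding_measure)"
      unfolding nn_integral_avoids[symmetric]
      by (rule nn_integral_ctmc_measure_mult[of _ "\<lambda>E. ennreal (E i / l)"]) measurable
    also have "(\<integral>\<^sup>+E. ennreal (E i / l) \<partial>holding_measure) = (\<integral>\<^sup>+E. ennreal (1 / l) * ennreal (E i) \<partial>holding_measure)"
      using l_pos by (intro nn_integral_cong) (simp add: ennreal_mult'[symmetric])
    also have "\<dots> = ennreal (1 / l)"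
      by (subst nn_integral_cmult) (simp_all add: nn_integral_holding_time)
    finally show "(\<integral>\<^sup>+\<omega>. avoids x i (fst \<omega>) * ennreal (snd \<omega> i / l) \<partial>?M) = avoid_prob x i x * ennreal (1 / l)" .
  qed
  also have "\<dots> = (\<Sum>i. avoid_prob x i x) * ennreal (1 / l)"
    by simp
  finally show ?thesis .
qed

text \<open>Summability enters twice. A trajectory that never returns would contribute infinitely
  many ones, so a return happens almost surely and \<open>cycle_time\<close> bounds the return time;
  its mean is then finite by the same sum.\<close>

lemma positive_recurrent_stateI:
  assumes fin: "(\<Sum>i. avoid_prob x i x) < \<infinity>"
  shows "positive_recurrent_state rate x"
proof -
  let ?M = "ctmc_measure rate (return_pmf x)"
  have "(\<integral>\<^sup>+\<omega>. (\<Sum>i. avoids x i (fst \<omega>)) \<partial>?M) = (\<Sum>i. \<integral>\<^sup>+\<omega>. avoids x i (fst \<omega>) \<partial>?M)"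
    by (intro nn_integral_suminf) measurable
  also have "\<dots> = (\<Sum>i. avoid_prob x i x)"
    by (simp add: nn_integral_ctmc_measure_fst[OF measurable_avoids] nn_integral_avoids)
  finally have "AE \<omega> in ?M. (\<Sum>i. avoids x i (fst \<omega>)) \<noteq> \<infinity>"
    using fin by (intro nn_integral_PInf_AE) auto
  then have "AE \<omega> in ?M. return_time rate x \<omega> \<le> cycle_time x \<omega>"
    using AE_ctmc_measure_holding_pos
  proof eventually_elim
    case (elim \<omega>)
    have "\<exists>k\<ge>1. fst \<omega> k = x"
    proof (rule ccontr)
      assume "\<not> ?thesis"
      then have "avoids x i (fst \<omega>) = 1" for i
        by (auto simp: avoids_eq)
      then have "(\<Sum>i. avoids x i (fst \<omega>)) = (\<Sum>i. 1 :: ennreal)"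
        by simp
      also have "\<dots> = \<infinity>"
        using nn_integral_count_space_nat[of "\<lambda>_. 1"] by simp
      finally show False
        using elim(1) by simp
    qed
    then show ?case
      using elim(2) by (intro return_time_le_cycle_time) auto
  qed
  then have "(\<integral>\<^sup>+\<omega>. return_time rate x \<omega> \<partial>?M) \<le> (\<integral>\<^sup>+\<omega>. cycle_time x \<omega> \<partial>?M)"
    by (rule nn_integral_mono_AE)
  also have "\<dots> \<le> (\<Sum>i. avoid_prob x i x) * ennreal (1 / l)"
    by (rule nn_integral_cycle_time)
  also have "\<dots> < \<infinity>"
    using fin by (simp add: ennreal_mult_less_top)
  finally show ?thesis
    by (simp add: positive_recurrent_state_def)
qed

lemma sum_avoid_prob_Suc:
  "(\<Sum>i<Suc n. avoid_prob x i y) = 1 + (\<integral>\<^sup>+z. indicator (- {x}) z * (\<Sum>i<n. avoid_prob x i z) \<partial>jump_pmf rate y)"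
  unfolding sum.lessThan_Suc_shift sum_distrib_left avoid_prob.simps by (subst nn_integral_sum) simp_all

text \<open>Off \<open>x\<close>, the drift says that one jump lowers \<open>W\<close> by at least 1
  on average. By induction on the truncation \<open>n\<close>, \<open>W\<close> dominates the mean
  number of jumps until \<open>x\<close> is hit. At \<open>x\<close> no drift is available, but one
  step from there reduces to the bound at the neighbours.\<close>

lemma positive_recurrent_state_Lyapunov:
  assumes closed: "\<And>y. y \<in> S \<Longrightarrow> nbrs y \<subseteq> S" and x: "x \<in> S"
    and W: "\<And>y. y \<in> S \<Longrightarrow> 0 \<le> W y"
    and drift: "\<And>y. y \<in> S \<Longrightarrow> y \<noteq> x \<Longrightarrow> flow W y + exit_rate rate y \<le> exit_rate rate y * W y"
  shows "positive_recurrent_state rate x"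
proof -
  have step: "(\<Sum>i<Suc n. avoid_prob x i y) \<le> 1 + ennreal (flow W y / exit_rate rate y)"
    if y: "y \<in> S" and n: "\<And>z. z \<in> S \<Longrightarrow> z \<noteq> x \<Longrightarrow> (\<Sum>i<n. avoid_prob x i z) \<le> ennreal (W z)" for n y
  proof -
    have "(\<integral>\<^sup>+z. indicator (- {x}) z * (\<Sum>i<n. avoid_prob x i z) \<partial>jump_pmf rate y) \<le>
        (\<integral>\<^sup>+z. ennreal (W z) \<partial>jump_pmf rate y)"
      unfolding nn_integral_jump_pmf
    proof (intro sum_mono mult_left_mono)
      fix z assume "z \<in> nbrs y"
      then have "z \<in> S" using closed y by auto
      then show "indicator (- {x}) z * (\<Sum>i<n. avoid_prob x i z) \<le> ennreal (W z)"
        using n[of z] by (cases "z = x") auto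
    qed simp
    also have "\<dots> = ennreal (flow W y / exit_rate rate y)"
      using closed[OF y] W by (intro nn_integral_jump_pmf_real) auto
    finally show ?thesis
      unfolding sum_avoid_prob_Suc by (intro add_left_mono)
  qed
  have flow_nonneg: "0 \<le> flow W y" if "y \<in> S" for y
    unfolding flow_def using closed[OF that] W by (intro sum_nonneg mult_nonneg_nonneg) auto
  have bound: "(\<Sum>i<n. avoid_prob x i y) \<le> ennreal (W y)" if "y \<in> S" "y \<noteq> x" for n y
    using that
  proof (induction n arbitrary: y)
    case (Suc n)
    have "(\<Sum>i<Suc n. avoid_prob x i y) \<le> 1 + ennreal (flow W y / exit_rate rate y)"
      using Suc by (intro step) auto
    also have "\<dots> = ennreal (1 + flow W y / exit_rate rate y)"
      using flow_nonneg[of y] Suc exit_pos[of y] by (subst ennreal_plus) auto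
    also have "\<dots> \<le> ennreal (W y)"
      using drift[of y] Suc exit_pos[of y] by (intro ennreal_leI) (simp add: field_simps)
    finally show ?case .
  qed simp
  have "(\<Sum>i. avoid_prob x i x) = (SUP n. \<Sum>i<n. avoid_prob x i x)"
    by (rule suminf_eq_SUP)
  also have "\<dots> \<le> 1 + ennreal (flow W x / exit_rate rate x)"
  proof (rule SUP_least)
    fix n
    have "(\<Sum>i<n. avoid_prob x i x) \<le> (\<Sum>i<Suc n. avoid_prob x i x)"
      by simp
    also have "\<dots> \<le> 1 + ennreal (flow W x / exit_rate rate x)"
      using x bound by (rule step)
    finally show "(\<Sum>i<n. avoid_prob x i x) \<le> 1 + ennreal (flow W x / exit_rate rate x)" .
  qed
  also have "\<dots> < \<infinity>"
    by simp
  finally show ?thesis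
    by (rule positive_recurrent_stateI)
qed

text \<open>The probability of visiting \<open>x\<close> within \<open>k\<close> steps from
  \<open>y\<close>. Here, unlike in \<open>avoid_prob\<close>, the starting point counts as a
  visit.\<close>

primrec hit :: "'s \<Rightarrow> nat \<Rightarrow> 's \<Rightarrow> real" where
  "hit x 0 y = of_bool (y = x)"
| "hit x (Suc k) y = (if y = x then 1 else flow (hit x k) y / exit_rate rate y)"

lemma hit_bounds: "0 \<le> hit x k y \<and> hit x k y \<le> 1"
proof (induction k arbitrary: y)
  case (Suc k)
  have "flow (hit x k) y \<le> flow (\<lambda>_. 1) y" "flow (\<lambda>_. 0) y \<le> flow (hit x k) y"
    using Suc by (auto intro!: flow_mono)
  then show ?case
    using exit_pos[of y] by (simp add: flow_const)
qed simp

lemma hit_mono: "hit x k y \<le> hit x (Suc k) y"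
proof (induction k arbitrary: y)
  case 0
  then show ?case
    using hit_bounds[of x "Suc 0" y] by (cases "y = x") (simp, simp del: hit.simps(2))
next
  case (Suc k)
  have "flow (hit x k) y \<le> flow (hit x (Suc k)) y"
    using Suc by (intro flow_mono)
  then show ?case
    using exit_pos[of y] by (simp add: divide_right_mono)
qed

lemma hit_pos:
  assumes "(y, x) \<in> edges\<^sup>*"
  shows "\<exists>k. 0 < hit x k y"
  using assms
proof (induction rule: converse_rtrancl_induct)
  case base
  show ?case by (rule exI[of _ 0]) simp
next
  case (step y z)
  then obtain k where k: "0 < hit x k z" by blast
  have z: "z \<in> nbrs y" "0 < rate y z"
    using step(1) by (auto simp: rate_pos_iff)
  have "0 < rate y z * hit x k z"
    using k z by simp
  also have "\<dots> \<le> flow (hit x k) y"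
    unfolding flow_def using z hit_bounds by (intro member_le_sum) auto
  finally have "0 < hit x (Suc k) y"
    using exit_pos[of y] by simp
  then show ?case by blast
qed

text \<open>
  The finite exceptional set \<open>F\<close> of the drift condition is reduced to the single state \<open>x\<close> by
  adding a multiple of \<open>\<Sum>k<N. 1 - hit x k\<close>, whose drift telescopes to \<open>- hit x N\<close> off \<open>x\<close>.
\<close>

lemma positive_recurrent_state_Foster:
  assumes closed: "\<And>y. y \<in> S \<Longrightarrow> nbrs y \<subseteq> S" and x: "x \<in> S"
    and reach: "\<And>y. y \<in> S \<Longrightarrow> (y, x) \<in> edges\<^sup>*"
    and V: "\<And>y. y \<in> S \<Longrightarrow> 0 \<le> V y"
    and F: "finite F" "F \<subseteq> S"
    and drift: "\<And>y. y \<in> S - F \<Longrightarrow> flow V y + exit_rate rate y \<le> exit_rate rate y * V y"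
  shows "positive_recurrent_state rate x"
proof -
  \<comment> \<open>One horizon serves all of the finite set, since \<open>hit\<close> increases
    with the horizon.\<close>
  have "\<exists>N. \<forall>y\<in>F. 0 < hit x N y"
    using F
  proof (induction F rule: finite_induct)
    case (insert y F)
    then obtain N where N: "\<forall>y\<in>F. 0 < hit x N y" by auto
    obtain k where k: "0 < hit x k y"
      using hit_pos reach insert by blast
    have m: "incseq (\<lambda>k. hit x k y)" for y
      using hit_mono by (intro incseq_SucI)
    have "0 < hit x (max N k) z" if "z \<in> insert y F" for z
      using that N k incseqD[OF m, of N "max N k" z] incseqD[OF m, of k "max N k" z] by fastforce
    then show ?case by blast
  qed auto
  then obtain N where N: "\<forall>y\<in>F. 0 < hit x N y" by blast
  obtain b where b: "0 \<le> b" "\<And>y. y \<in> F \<Longrightarrow> flow V y + exit_rate rate y - exit_rate rate y * V y \<le> b * (exit_rate rate y * hit x N y)"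
  proof -
    define q where "q y = exit_rate rate y * hit x N y" for y
    have q: "0 \<le> q y" for y
      using exit_pos[of y] hit_bounds[of x N y] by (simp add: q_def)
    \<comment> \<open>The ratio of the defect of the drift condition to the gain \<open>q y\<close>
      from the correction term; \<open>q y\<close> is positive on \<open>F\<close> by the choice of
      \<open>N\<close>. The sum of these nonnegative ratios is a multiplier that works for all of
      \<open>F\<close> at once.\<close>
    define c where "c y = \<bar>flow V y + exit_rate rate y - exit_rate rate y * V y\<bar> / q y" for y
    have c: "0 \<le> c y" for y
      using q by (simp add: c_def)
    show ?thesis
    proof (rule that[of "\<Sum>y\<in>F. c y"])
      show "0 \<le> (\<Sum>y\<in>F. c y)"
        using c by (intro sum_nonneg)
      fix y assume y: "y \<in> F"
      then have p: "0 < q y"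
        using N exit_pos[of y] by (simp add: q_def)
      have "flow V y + exit_rate rate y - exit_rate rate y * V y \<le> c y * q y"
        using p by (simp add: c_def)
      also have "\<dots> \<le> (\<Sum>y\<in>F. c y) * q y"
        using p y c F by (intro mult_right_mono member_le_sum) auto
      finally show "flow V y + exit_rate rate y - exit_rate rate y * V y \<le> (\<Sum>y\<in>F. c y) * (exit_rate rate y * hit x N y)"
        unfolding q_def .
    qed
  qed
  define W where "W y = V y + b * (\<Sum>k<N. 1 - hit x k y)" for y
  show ?thesis
  proof (rule positive_recurrent_state_Lyapunov[OF closed x])
    show "0 \<le> W y" if "y \<in> S" for y
      unfolding W_def using V[OF that] b(1) hit_bounds
      by (intro add_nonneg_nonneg mult_nonneg_nonneg sum_nonneg) auto
    fix y assume y: "y \<in> S" "y \<noteq> x"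
    have "flow W y = flow V y + b * (\<Sum>k<N. flow (\<lambda>y. 1 - hit x k y) y)"
      by (simp add: W_def[abs_def] flow_add flow_cmult flow_sum)
    also have "(\<Sum>k<N. flow (\<lambda>y. 1 - hit x k y) y) = (\<Sum>k<N. exit_rate rate y * (1 - hit x (Suc k) y))"
    proof (intro sum.cong refl)
      fix k
      show "flow (\<lambda>y. 1 - hit x k y) y = exit_rate rate y * (1 - hit x (Suc k) y)"
        using y(2) exit_pos[of y] by (simp add: flow_diff flow_const field_simps)
    qed
    also have "\<dots> = exit_rate rate y * (\<Sum>k<N. (1 - hit x k y) - (hit x (Suc k) y - hit x k y))"
      by (simp add: sum_distrib_left)
    \<comment> \<open>The lower end \<open>hit x 0 y\<close> of the telescoping sum is 0, because
      \<open>y\<close> differs from \<open>x\<close>.\<close>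
    also have "(\<Sum>k<N. (1 - hit x k y) - (hit x (Suc k) y - hit x k y)) = (\<Sum>k<N. 1 - hit x k y) - hit x N y"
      using y(2) sum_lessThan_telescope[of "\<lambda>k. hit x k y" N]
      by (simp only: sum_subtractf hit.simps(1)) simp
    finally have "flow W y + exit_rate rate y - exit_rate rate y * W y =
        flow V y + exit_rate rate y - exit_rate rate y * V y - b * (exit_rate rate y * hit x N y)"
      by (simp add: W_def[of y] algebra_simps)
    also have "\<dots> \<le> 0"
    proof (cases "y \<in> F")
      case True
      then show ?thesis using b(2)[of y] by simp
    next
      case False
      then have "flow V y + exit_rate rate y \<le> exit_rate rate y * V y"
        using drift y by simp
      moreover have "0 \<le> b * (exit_rate rate y * hit x N y)"
        using b(1) exit_pos[of y] hit_bounds[of x N y] by simp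
      ultimately show ?thesis by linarith
    qed
    finally show "flow W y + exit_rate rate y \<le> exit_rate rate y * W y" by simp
  qed
qed

end

section \<open>Excessive distributions\<close>

context bounded_rates
begin

text \<open>The state type may be uncountable, so its counting measure need not be sigma-finite; the
  interchange passes through the counting measure on pairs.\<close>

lemma nn_integral_flow_swap:
  fixes p h :: "'s \<Rightarrow> ennreal"
  shows "(\<integral>\<^sup>+y. (\<integral>\<^sup>+x. p x * ennreal (rate x y) \<partial>count_space UNIV) * h y \<partial>count_space UNIV) =
    (\<integral>\<^sup>+x. p x * (\<Sum>y\<in>nbrs x. ennreal (rate x y) * h y) \<partial>count_space UNIV)"
proof -
  have "(\<integral>\<^sup>+y. (\<integral>\<^sup>+x. p x * ennreal (rate x y) \<partial>count_space UNIV) * h y \<partial>count_space UNIV) =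
      (\<integral>\<^sup>+y. \<integral>\<^sup>+x. p x * (ennreal (rate x y) * h y) \<partial>count_space UNIV \<partial>count_space UNIV)"
    by (intro nn_integral_cong) (simp add: nn_integral_multc[symmetric] mult.assoc)
  also have "\<dots> = (\<integral>\<^sup>+x. \<integral>\<^sup>+y. p x * (ennreal (rate x y) * h y) \<partial>count_space UNIV \<partial>count_space UNIV)"
    using nn_integral_fst_count_space[of "\<lambda>(x, y). p x * (ennreal (rate x y) * h y)"]
      nn_integral_snd_count_space[of "\<lambda>(x, y). p x * (ennreal (rate x y) * h y)"]
    by simp
  also have "\<dots> = (\<integral>\<^sup>+x. p x * (\<Sum>y\<in>nbrs x. ennreal (rate x y) * h y) \<partial>count_space UNIV)"
  proof (intro nn_integral_cong)
    fix x
    have "(\<integral>\<^sup>+y. p x * (ennreal (rate x y) * h y) \<partial>count_space UNIV) =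
        p x * (\<integral>\<^sup>+y. ennreal (rate x y) * h y \<partial>count_space UNIV)"
      by (rule nn_integral_cmult) simp
    also have "(\<integral>\<^sup>+y. ennreal (rate x y) * h y \<partial>count_space UNIV) = (\<Sum>y\<in>nbrs x. ennreal (rate x y) * h y)"
      by (intro nn_integral_count_space' finite_nbrs) (auto simp: nbrs_def)
    finally show "(\<integral>\<^sup>+y. p x * (ennreal (rate x y) * h y) \<partial>count_space UNIV) =
        p x * (\<Sum>y\<in>nbrs x. ennreal (rate x y) * h y)" .
  qed
  finally show ?thesis .
qed

text \<open>Extends the defining inequality to states outside \<open>S\<close>, where the inflow
  vanishes because \<open>\<pi>\<close> is carried by the closed set \<open>S\<close>. Integrals can
  then range over the whole type.\<close>

lemma excessive_inflow:
  assumes ex: "excessive S \<pi>" and closed: "\<And>x. x \<in> S \<Longrightarrow> nbrs x \<subseteq> S"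
  shows "(\<integral>\<^sup>+x. ennreal (pmf \<pi> x) * ennreal (rate x y) \<partial>count_space UNIV) \<le>
    ennreal (exit_rate rate y) * ennreal (pmf \<pi> y)"
proof (cases "y \<in> S")
  case True
  then show ?thesis
    using ex exit_pos[of y] unfolding nn_integral_measure_pmf[symmetric]
    by (simp add: excessive_def less_imp_le flip: ennreal_mult)
next
  case False
  have "ennreal (pmf \<pi> x) * ennreal (rate x y) = 0" for x
  proof (cases "x \<in> set_pmf \<pi>")
    case True
    then have "y \<notin> nbrs x"
      using ex closed \<open>y \<notin> S\<close> by (auto simp: excessive_def)
    then show ?thesis by (simp add: nbrs_def)
  qed (simp add: set_pmf_iff)
  then show ?thesis by (simp del: mult_eq_0_iff)
qed

lemma excessive_flow:
  assumes ex: "excessive S \<pi>" and closed: "\<And>x. x \<in> S \<Longrightarrow> nbrs x \<subseteq> S"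
    and f: "\<And>x. 0 \<le> f x"
  shows "(\<integral>\<^sup>+x. ennreal (flow f x) \<partial>\<pi>) \<le> (\<integral>\<^sup>+x. ennreal (exit_rate rate x * f x) \<partial>\<pi>)"
proof -
  have "(\<integral>\<^sup>+x. ennreal (flow f x) \<partial>\<pi>) =
      (\<integral>\<^sup>+x. ennreal (pmf \<pi> x) * (\<Sum>y\<in>nbrs x. ennreal (rate x y) * ennreal (f y)) \<partial>count_space UNIV)"
    unfolding nn_integral_measure_pmf flow_def using f by (simp add: sum_ennreal flip: ennreal_mult)
  also have "\<dots> = (\<integral>\<^sup>+y. (\<integral>\<^sup>+x. ennreal (pmf \<pi> x) * ennreal (rate x y) \<partial>count_space UNIV) * ennreal (f y) \<partial>count_space UNIV)"
    by (rule nn_integral_flow_swap[symmetric])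
  also have "\<dots> \<le> (\<integral>\<^sup>+y. (ennreal (exit_rate rate y) * ennreal (pmf \<pi> y)) * ennreal (f y) \<partial>count_space UNIV)"
    using ex closed by (intro nn_integral_mono mult_right_mono excessive_inflow) auto
  also have "\<dots> = (\<integral>\<^sup>+x. ennreal (exit_rate rate x * f x) \<partial>\<pi>)"
    unfolding nn_integral_measure_pmf using f exit_pos
    by (intro nn_integral_cong) (simp add: ennreal_mult less_imp_le mult_ac)
  finally show ?thesis .
qed

text \<open>
  The drift condition is applied to the bounded function \<open>min f M\<close>, so that no a priori
  integrability of \<open>f\<close> is needed.
\<close>

lemma excessive_drift_bound:
  assumes ex: "excessive S \<pi>" and closed: "\<And>x. x \<in> S \<Longrightarrow> nbrs x \<subseteq> S"
    and nonneg: "\<And>x. 0 \<le> f x" "\<And>x. 0 \<le> g x" "\<And>x. 0 \<le> b x"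
    and drift: "\<And>x. x \<in> S \<Longrightarrow> flow f x + g x \<le> exit_rate rate x * f x + b x"
  shows "(\<integral>\<^sup>+x. ennreal (g x) \<partial>\<pi>) \<le> (\<integral>\<^sup>+x. ennreal (b x) \<partial>\<pi>)"
proof -
  have trunc: "(\<integral>\<^sup>+x. ennreal (g x) * indicator {x. f x < real M} x \<partial>\<pi>) \<le> (\<integral>\<^sup>+x. ennreal (b x) \<partial>\<pi>)" for M :: nat
  proof -
    \<comment> \<open>Excessiveness only tests nonnegative functions, and only in one direction. To
      bound the drift of \<open>min f M\<close> from below in the mean, it is therefore applied to
      the nonnegative function \<open>M - min f M\<close>.\<close>
    define h where "h x = real M - min (f x) (real M)" for x
    have h: "0 \<le> h x" "h x \<le> real M" for x
      using nonneg(1)[of x] by (auto simp: h_def)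
    have pw: "ennreal (exit_rate rate x * h x) + ennreal (g x) * indicator {x. f x < real M} x \<le>
        ennreal (flow h x) + ennreal (b x)" if x: "x \<in> S" for x
    proof (cases "f x < real M")
      case True
      have "flow h x = exit_rate rate x * real M - flow (\<lambda>y. min (f y) (real M)) x"
        by (simp add: h_def[abs_def] flow_diff flow_const)
      moreover have "flow (\<lambda>y. min (f y) (real M)) x \<le> flow f x"
        by (intro flow_mono) auto
      ultimately have le: "exit_rate rate x * h x + g x \<le> flow h x + b x"
        using drift[OF x] True by (simp add: h_def algebra_simps)
      have "0 \<le> flow h x"
        unfolding flow_def using h by (intro sum_nonneg mult_nonneg_nonneg) auto
      then show ?thesis
        using le True h[of x] nonneg(2,3)[of x] exit_pos[of x]
        by (simp add: less_imp_le flip: ennreal_plus)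
    next
      \<comment> \<open>At such a state the truncated function is maximal: \<open>h x\<close> and
        the indicator both vanish, so the left side is 0.\<close>
      case False
      then show ?thesis by (simp add: h_def)
    qed
    have "(\<integral>\<^sup>+x. ennreal (exit_rate rate x * h x) \<partial>\<pi>) + (\<integral>\<^sup>+x. ennreal (g x) * indicator {x. f x < real M} x \<partial>\<pi>) =
        (\<integral>\<^sup>+x. ennreal (exit_rate rate x * h x) + ennreal (g x) * indicator {x. f x < real M} x \<partial>\<pi>)"
      by (rule nn_integral_add[symmetric]) auto
    also have "\<dots> \<le> (\<integral>\<^sup>+x. ennreal (flow h x) + ennreal (b x) \<partial>\<pi>)"
      using ex pw by (intro nn_integral_mono_AE) (auto simp: AE_measure_pmf_iff excessive_def)
    also have "\<dots> = (\<integral>\<^sup>+x. ennreal (flow h x) \<partial>\<pi>) + (\<integral>\<^sup>+x. ennreal (b x) \<partial>\<pi>)"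
      by (rule nn_integral_add) auto
    also have "\<dots> \<le> (\<integral>\<^sup>+x. ennreal (exit_rate rate x * h x) \<partial>\<pi>) + (\<integral>\<^sup>+x. ennreal (b x) \<partial>\<pi>)"
      using ex closed h by (intro add_right_mono excessive_flow) auto
    finally have le: "(\<integral>\<^sup>+x. ennreal (exit_rate rate x * h x) \<partial>\<pi>) + (\<integral>\<^sup>+x. ennreal (g x) * indicator {x. f x < real M} x \<partial>\<pi>)
        \<le> (\<integral>\<^sup>+x. ennreal (exit_rate rate x * h x) \<partial>\<pi>) + (\<integral>\<^sup>+x. ennreal (b x) \<partial>\<pi>)" .
    \<comment> \<open>The common term is finite thanks to the truncation and the bound
      \<open>u\<close>, hence it cancels in \<open>ennreal\<close>.\<close>
    have "(\<integral>\<^sup>+x. ennreal (exit_rate rate x * h x) \<partial>\<pi>) \<le> (\<integral>\<^sup>+x. ennreal (u * real M) \<partial>\<pi>)"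
      using h exit_le exit_pos u_pos by (intro nn_integral_mono ennreal_leI mult_mono) (auto simp: less_imp_le)
    also have "\<dots> < \<infinity>"
      by simp
    finally show ?thesis
      using le by (auto simp: ennreal_add_left_cancel_le)
  qed
  have "(\<integral>\<^sup>+x. ennreal (g x) \<partial>\<pi>) = (\<integral>\<^sup>+x. (SUP M. ennreal (g x) * indicator {x. f x < real M} x) \<partial>\<pi>)"
  proof (intro nn_integral_cong antisym)
    fix x
    obtain M :: nat where "f x < real M"
      using reals_Archimedean2 by blast
    then show "ennreal (g x) \<le> (SUP M. ennreal (g x) * indicator {x. f x < real M} x)"
      by (intro SUP_upper2[of M]) auto
    show "(SUP M. ennreal (g x) * indicator {x. f x < real M} x) \<le> ennreal (g x)"
      by (intro SUP_least) (auto simp: indicator_def)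
  qed
  also have "\<dots> = (SUP M. \<integral>\<^sup>+x. ennreal (g x) * indicator {x. f x < real M} x \<partial>\<pi>)"
    by (intro nn_integral_monotone_convergence_SUP) (auto simp: incseq_def le_fun_def indicator_def)
  also have "\<dots> \<le> (\<integral>\<^sup>+x. ennreal (b x) \<partial>\<pi>)"
    using trunc by (rule SUP_least)
  finally show ?thesis .
qed

text \<open>
  The pointwise minimum of two excessive distributions is excessive, hence it satisfies the balance
  equations exactly; so the set where it differs from one of the two is closed under transitions.
\<close>

lemma excessive_unique:
  assumes ex: "excessive S \<pi>" "excessive S \<pi>'" and closed: "\<And>x. x \<in> S \<Longrightarrow> nbrs x \<subseteq> S"
    and reach: "\<And>x y. x \<in> S \<Longrightarrow> y \<in> S \<Longrightarrow> (x, y) \<in> edges\<^sup>*"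
  shows "\<pi> = \<pi>'"
proof (rule ccontr)
  assume neq: "\<pi> \<noteq> \<pi>'"
  define \<nu> where "\<nu> x = min (pmf \<pi> x) (pmf \<pi>' x)" for x
  have \<nu>: "0 \<le> \<nu> x" "\<nu> x \<le> pmf \<pi> x" "\<nu> x \<le> pmf \<pi>' x" for x
    by (auto simp: \<nu>_def)
  let ?C = "count_space UNIV"
  define F where "F y = (\<integral>\<^sup>+x. ennreal (\<nu> x) * ennreal (rate x y) \<partial>?C)" for y
  define G where "G y = ennreal (exit_rate rate y) * ennreal (\<nu> y)" for y
  have FG: "F y \<le> G y" for y
  proof -
    have "F y \<le> (\<integral>\<^sup>+x. ennreal (pmf \<pi> x) * ennreal (rate x y) \<partial>?C)"
      "F y \<le> (\<integral>\<^sup>+x. ennreal (pmf \<pi>' x) * ennreal (rate x y) \<partial>?C)"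
      unfolding F_def using \<nu> by (auto intro!: nn_integral_mono mult_right_mono ennreal_leI)
    then have "F y \<le> ennreal (exit_rate rate y) * ennreal (pmf \<pi> y)"
      "F y \<le> ennreal (exit_rate rate y) * ennreal (pmf \<pi>' y)"
      using excessive_inflow[OF ex(1) closed, of y] excessive_inflow[OF ex(2) closed, of y]
      by (auto intro: order_trans)
    then show ?thesis
      unfolding G_def \<nu>_def by (auto simp: min_def)
  qed
  \<comment> \<open>Total inflow equals total outflow for any weight, since the rates out of a state
    sum to its exit rate. As the total is finite, the pointwise inequality \<open>FG\<close> must be
    an equality everywhere.\<close>
  have F_int: "(\<integral>\<^sup>+y. F y \<partial>?C) = (\<integral>\<^sup>+y. G y \<partial>?C)"
  proof -
    have "(\<integral>\<^sup>+y. F y \<partial>?C) = (\<integral>\<^sup>+x. ennreal (\<nu> x) * (\<Sum>y\<in>nbrs x. ennreal (rate x y)) \<partial>?C)"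
      using nn_integral_flow_swap[of "\<lambda>x. ennreal (\<nu> x)" "\<lambda>_. 1"] by (simp add: F_def)
    also have "\<dots> = (\<integral>\<^sup>+y. G y \<partial>?C)"
      by (simp add: G_def exit_rate_eq sum_ennreal mult.commute)
    finally show ?thesis .
  qed
  have G_fin: "(\<integral>\<^sup>+y. G y \<partial>?C) \<noteq> \<infinity>"
  proof -
    have "(\<integral>\<^sup>+y. G y \<partial>?C) \<le> (\<integral>\<^sup>+y. ennreal (pmf \<pi> y) * ennreal u \<partial>?C)"
      unfolding G_def mult.commute[of "ennreal (exit_rate rate _)"]
      using \<nu> exit_le by (intro nn_integral_mono mult_mono ennreal_leI) auto
    also have "\<dots> = ennreal u"
      using nn_integral_measure_pmf[of \<pi> "\<lambda>_. ennreal u"] by simp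
    finally show ?thesis
      by (auto simp: top_unique)
  qed
  have eq: "F y = G y" for y
  proof (rule ccontr)
    assume "F y \<noteq> G y"
    then have "\<not> (AE y in ?C. G y \<le> F y)"
      using FG by (auto simp: AE_count_space intro: antisym)
    then have "(\<integral>\<^sup>+y. F y \<partial>?C) < (\<integral>\<^sup>+y. G y \<partial>?C)"
      using FG F_int G_fin by (intro nn_integral_less) (auto simp: AE_count_space)
    then show False
      using F_int by simp
  qed
  have col: "(\<integral>\<^sup>+x. ennreal (p x) * ennreal (rate x y) \<partial>?C) = ennreal (\<Sum>x | rate x y \<noteq> 0. p x * rate x y)"
    if "\<And>x. 0 \<le> p x" for p :: "'s \<Rightarrow> real" and y
  proof -
    have "(\<integral>\<^sup>+x. ennreal (p x) * ennreal (rate x y) \<partial>?C) = (\<Sum>x | rate x y \<noteq> 0. ennreal (p x) * ennreal (rate x y))"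
      using column_finite by (intro nn_integral_count_space') auto
    then show ?thesis
      using that by (simp add: sum_ennreal flip: ennreal_mult)
  qed
  \<comment> \<open>A strict deficit of \<open>\<nu>\<close> at \<open>y\<close> makes its inflow
    into \<open>z\<close> strictly smaller than that of \<open>\<pi>'\<close>. Balance for
    \<open>\<nu>\<close> against the inequality for \<open>\<pi>'\<close> then gives a deficit at
    \<open>z\<close>.\<close>
  have step: "\<nu> z < pmf \<pi>' z" if y: "\<nu> y < pmf \<pi>' y" and yz: "0 < rate y z" for y z
  proof -
    have "(\<Sum>x | rate x z \<noteq> 0. \<nu> x * rate x z) = exit_rate rate z * \<nu> z"
      using eq[of z, unfolded F_def G_def col[OF \<nu>(1)]] \<nu>(1) exit_pos[of z]
      by (simp add: sum_nonneg less_imp_le flip: ennreal_mult)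
    moreover have "(\<Sum>x | rate x z \<noteq> 0. \<nu> x * rate x z) < (\<Sum>x | rate x z \<noteq> 0. pmf \<pi>' x * rate x z)"
    proof (rule sum_strict_mono_ex1)
      show "\<exists>x\<in>{x. rate x z \<noteq> 0}. \<nu> x * rate x z < pmf \<pi>' x * rate x z"
        using y yz by (intro bexI[of _ y]) auto
    qed (use \<nu> column_finite in \<open>auto intro!: mult_right_mono\<close>)
    moreover have "(\<Sum>x | rate x z \<noteq> 0. pmf \<pi>' x * rate x z) \<le> exit_rate rate z * pmf \<pi>' z"
      using excessive_inflow[OF ex(2) closed, of z, unfolded col[OF pmf_nonneg]] exit_pos[of z]
      by (simp add: sum_nonneg less_imp_le flip: ennreal_mult)
    ultimately have "exit_rate rate z * \<nu> z < exit_rate rate z * pmf \<pi>' z"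
      by linarith
    then show ?thesis
      using exit_pos[of z] by simp
  qed
  \<comment> \<open>Both laws have total mass 1, so each exceeds the other somewhere. The deficit at
    \<open>x\<close> spreads along edges to \<open>y\<close>, where the minimum equals
    \<open>\<pi>'\<close>.\<close>
  obtain x y where xy: "pmf \<pi> x < pmf \<pi>' x" "pmf \<pi>' y < pmf \<pi> y"
    using pmf_neq_exists_less[OF neq] pmf_neq_exists_less[OF neq[symmetric]] by blast
  have "x \<in> set_pmf \<pi>'" "y \<in> set_pmf \<pi>"
    using xy pmf_nonneg[of \<pi> x] pmf_nonneg[of \<pi>' y] by (auto simp: set_pmf_iff simp del: pmf_nonneg)
  then have "x \<in> S" "y \<in> S"
    using ex by (auto simp: excessive_def)
  then have "(x, y) \<in> edges\<^sup>*"
    by (rule reach)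
  then have "\<nu> y < pmf \<pi>' y"
    using xy(1) by induction (auto simp: \<nu>_def intro: step[unfolded \<nu>_def])
  then show False
    using xy(2) by (simp add: \<nu>_def)
qed

end

section \<open>The queueing network\<close>

lemma card_supersets_singleton:
  assumes "finite A" "j \<in> A" "0 < d"
  shows "card {c. c \<subseteq> A \<and> card c = d \<and> j \<in> c} = (card A - 1) choose (d - 1)"
proof -
  have "bij_betw (insert j) {c. c \<subseteq> A - {j} \<and> card c = d - 1} {c. c \<subseteq> A \<and> card c = d \<and> j \<in> c}"
  proof (rule bij_betwI[where g = "\<lambda>c. c - {j}"])
    have fin: "finite c" if "c \<subseteq> A" for c
      using assms(1) that by (rule rev_finite_subset)
    show "insert j \<in> {c. c \<subseteq> A - {j} \<and> card c = d - 1} \<rightarrow> {c. c \<subseteq> A \<and> card c = d \<and> j \<in> c}"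
    proof
      fix c assume "c \<in> {c. c \<subseteq> A - {j} \<and> card c = d - 1}"
      moreover from this have "finite c" "j \<notin> c"
        using fin[of c] by auto
      ultimately show "insert j c \<in> {c. c \<subseteq> A \<and> card c = d \<and> j \<in> c}"
        using assms by auto
    qed
    show "(\<lambda>c. c - {j}) \<in> {c. c \<subseteq> A \<and> card c = d \<and> j \<in> c} \<rightarrow> {c. c \<subseteq> A - {j} \<and> card c = d - 1}"
      using fin by auto
  qed auto
  then have "card {c. c \<subseteq> A \<and> card c = d \<and> j \<in> c} = card {c. c \<subseteq> A - {j} \<and> card c = d - 1}"
    by (rule bij_betw_same_card[symmetric])
  also have "\<dots> = (card A - 1) choose (d - 1)"
    using assms by (simp add: n_subsets)
  finally show ?thesis .
qed

text \<open>Cauchy-Schwarz for the vectors of entries \<open>sqrt (1 / q j)\<close> and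
  \<open>sqrt (q j)\<close>, whose inner product counts the elements of \<open>c\<close>.\<close>

lemma square_le_sum_times_sum_inverse:
  fixes q :: "'a \<Rightarrow> real"
  assumes "\<And>j. j \<in> c \<Longrightarrow> 0 < q j"
  shows "(real (card c))\<^sup>2 \<le> (\<Sum>j\<in>c. 1 / q j) * (\<Sum>j\<in>c. q j)"
proof -
  have "(\<Sum>j\<in>c. sqrt (1 / q j) * sqrt (q j))\<^sup>2 \<le> (\<Sum>j\<in>c. (sqrt (1 / q j))\<^sup>2) * (\<Sum>j\<in>c. (sqrt (q j))\<^sup>2)"
    by (rule Cauchy_Schwarz_ineq_sum)
  moreover have "(\<Sum>j\<in>c. sqrt (1 / q j) * sqrt (q j)) = (\<Sum>j\<in>c. 1)"
    using assms by (intro sum.cong refl) (simp add: less_imp_neq[symmetric] flip: real_sqrt_mult)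
  moreover have "(\<Sum>j\<in>c. (sqrt (1 / q j))\<^sup>2) = (\<Sum>j\<in>c. 1 / q j)"
    using assms by (intro sum.cong refl) (simp add: less_imp_le)
  moreover have "(\<Sum>j\<in>c. (sqrt (q j))\<^sup>2) = (\<Sum>j\<in>c. q j)"
    using assms by (intro sum.cong refl) (simp add: less_imp_le)
  ultimately show ?thesis
    by simp
qed

locale queueing_network =
  fixes n d :: nat and lam :: real
  assumes d_pos: "1 \<le> d" and d_le_n: "d \<le> n" and lam_pos: "0 < lam" and lam_less: "lam < 1"
begin

abbreviation "C \<equiv> classes n d"
abbreviation "Q \<equiv> queue_length n d"
abbreviation "a \<equiv> arrival_rate n d lam"
abbreviation "dep \<equiv> departure_rate n d"
abbreviation "inc x c \<equiv> x(c := Suc (x c))"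
abbreviation "dec x c \<equiv> x(c := x c - Suc 0)"

lemma network_rate_eq: "network_rate n d lam x y =
    (\<Sum>c\<in>C. (if y = inc x c then a else 0) + (if 0 < x c \<and> y = dec x c then dep x c else 0))"
  by (simp add: network_rate_def)

lemma finite_C [simp]: "finite C"
  by (rule finite_subset[of _ "Pow {1..n}"]) (auto simp: classes_def)

lemma card_C: "card C = n choose d"
  using n_subsets[of "{1..n}" d] by (simp add: classes_def)

lemma finite_class: "c \<in> C \<Longrightarrow> finite c"
  using finite_subset[of c "{1..n}"] by (simp add: classes_def)

lemma n_pos: "0 < n"
  using d_pos d_le_n by linarith

lemma choose_pos: "0 < n choose d"
  using d_le_n by (simp add: zero_less_binomial)

lemma a_pos: "0 < a"
  using n_pos lam_pos choose_pos by (simp add: arrival_rate_def)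

lemma a_card_C: "a * real (card C) = real n * lam"
  using choose_pos by (simp add: arrival_rate_def card_C)

text \<open>The total arrival rate at one server. It is \<lambda> \<open>d\<close> and not
  \<lambda>, because every job is present at \<open>d\<close> servers.\<close>

lemma a_card_containing:
  assumes "j \<in> {1..n}"
  shows "a * real (card {c \<in> C. j \<in> c}) = lam * real d"
proof -
  have "card {c \<in> C. j \<in> c} = (n - 1) choose (d - 1)"
    using card_supersets_singleton[of "{1..n}" j d] assms d_pos by (simp add: classes_def)
  moreover have "d * (n choose d) = n * ((n - 1) choose (d - 1))"
    using d_pos by (intro times_binomial_minus1_eq) auto
  then have "real d * real (n choose d) = real n * real ((n - 1) choose (d - 1))"
    by (metis of_nat_mult)
  ultimately show ?thesis
    using choose_pos by (simp add: arrival_rate_def field_simps)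
qed

lemma sum_class_swap:
  "(\<Sum>c\<in>C. \<Sum>j\<in>c. g c j) = (\<Sum>j=1..n. \<Sum>c\<in>{c \<in> C. j \<in> c}. g c j)" for g :: "nat set \<Rightarrow> nat \<Rightarrow> real"
proof -
  have "(\<Sum>c\<in>C. \<Sum>j\<in>c. g c j) = (\<Sum>c\<in>C. \<Sum>j\<in>{j \<in> {1..n}. j \<in> c}. g c j)"
    by (intro sum.cong) (auto simp: classes_def)
  also have "\<dots> = (\<Sum>j=1..n. \<Sum>c\<in>{c \<in> C. j \<in> c}. g c j)"
    by (rule sum.swap_restrict) auto
  finally show ?thesis .
qed

lemma dep_nonneg: "0 \<le> dep x c"
  by (auto simp: departure_rate_def intro!: mult_nonneg_nonneg sum_nonneg)

lemma dep_eq: "dep x c = real (x c) * (\<Sum>j\<in>c. 1 / real (Q x j))"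
  by (simp add: departure_rate_def)

lemma real_queue: "real (Q x j) = (\<Sum>c\<in>{c \<in> C. j \<in> c}. real (x c))"
  by (simp add: queue_length_def)

lemma le_queue: "c \<in> C \<Longrightarrow> j \<in> c \<Longrightarrow> x c \<le> Q x j"
  unfolding queue_length_def by (intro member_le_sum) auto

lemma dep_pos:
  assumes "c \<in> C" "0 < x c"
  shows "0 < dep x c"
proof -
  have "c \<noteq> {}"
    using assms(1) d_pos by (auto simp: classes_def)
  then have "0 < (\<Sum>j\<in>c. 1 / real (Q x j))"
    using assms finite_class le_queue[of c _ x] by (intro sum_pos) fastforce+
  then show ?thesis
    using assms by (simp add: dep_eq)
qed

definition busy :: "(nat set \<Rightarrow> nat) \<Rightarrow> real" where
  "busy x = real (card {j \<in> {1..n}. 0 < Q x j})"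

lemma busy_bounds: "0 \<le> busy x" "busy x \<le> real n"
proof -
  have "card {j \<in> {1..n}. 0 < Q x j} \<le> card {1..n}"
    by (intro card_mono) auto
  then show "busy x \<le> real n"
    by (simp add: busy_def)
qed (simp add: busy_def)

text \<open>Summed by servers instead of classes, a busy server contributes its full unit rate,
  shared among its jobs.\<close>

lemma sum_dep: "(\<Sum>c\<in>C. dep x c) = busy x"
proof -
  have "(\<Sum>c\<in>C. dep x c) = (\<Sum>j=1..n. \<Sum>c\<in>{c \<in> C. j \<in> c}. real (x c) * (1 / real (Q x j)))"
    unfolding dep_eq sum_distrib_left by (rule sum_class_swap)
  also have "\<dots> = (\<Sum>j=1..n. real (Q x j) * (1 / real (Q x j)))"
    by (intro sum.cong refl) (simp only: real_queue sum_distrib_right)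
  \<comment> \<open>An idle server contributes 0, also through the convention
    \<open>1 / 0 = 0\<close>.\<close>
  also have "\<dots> = (\<Sum>j=1..n. of_bool (0 < Q x j))"
    by (intro sum.cong) auto
  also have "\<dots> = busy x"
    by (simp add: busy_def Int_def)
  finally show ?thesis .
qed

section \<open>The network as a chain with bounded rates\<close>

lemma network_rate_cases:
  assumes "network_rate n d lam x y \<noteq> 0"
  obtains c where "c \<in> C" "y = inc x c" | c where "c \<in> C" "0 < x c" "y = dec x c"
proof -
  have "\<exists>c\<in>C. (if y = inc x c then a else 0) + (if 0 < x c \<and> y = dec x c then dep x c else 0) \<noteq> 0"
    using assms unfolding network_rate_eq by (meson sum.neutral)
  then show thesis
    using that by (auto split: if_splits)
qed

sublocale finite_rates "network_rate n d lam"
proof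
  fix x y :: "nat set \<Rightarrow> nat"
  show "0 \<le> network_rate n d lam x y"
    unfolding network_rate_eq using a_pos dep_nonneg by (intro sum_nonneg) (auto simp: less_imp_le)
  show "finite {y. network_rate n d lam x y \<noteq> 0}"
    by (rule finite_subset[of _ "inc x ` C \<union> dec x ` C"]) (auto elim: network_rate_cases)
  \<comment> \<open>Predecessors are found by undoing a transition: an arrival into \<open>y\<close>
    came from \<open>dec y c\<close>, a departure from \<open>inc y c\<close>.\<close>
  have source: "x \<in> dec y ` C \<union> inc y ` C" if "network_rate n d lam x y \<noteq> 0" for x
    using that
  proof (cases rule: network_rate_cases)
    case (1 c)
    then have "x = dec y c" by auto
    with 1 show ?thesis by blast
  next
    case (2 c)
    then have "x = inc y c" by auto
    with 2 show ?thesis by blast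
  qed
  show "finite {x. network_rate n d lam x y \<noteq> 0}"
  proof (rule finite_subset)
    show "{x. network_rate n d lam x y \<noteq> 0} \<subseteq> dec y ` C \<union> inc y ` C"
      using source by blast
  qed simp
  show "network_rate n d lam x x = 0"
  proof (rule ccontr)
    assume "network_rate n d lam x x \<noteq> 0"
    then show False
    proof (rule network_rate_cases)
      fix c assume "x = inc x c"
      from fun_cong[OF this, of c] show False by simp
    next
      fix c assume "0 < x c" "x = dec x c"
      from this(1) fun_cong[OF this(2), of c] show False by simp
    qed
  qed
qed

lemma flow_network: "flow f x = (\<Sum>c\<in>C. a * f (inc x c) + dep x c * f (dec x c))"
proof -
  let ?A = "inc x ` C \<union> dec x ` C"
  have "flow f x = (\<Sum>y\<in>?A. network_rate n d lam x y * f y)"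
    by (rule flow_superset) (auto simp: nbrs_def elim: network_rate_cases)
  also have "\<dots> = (\<Sum>c\<in>C. \<Sum>y\<in>?A. ((if y = inc x c then a else 0) +
      (if 0 < x c \<and> y = dec x c then dep x c else 0)) * f y)"
    unfolding network_rate_eq sum_distrib_right by (rule sum.swap)
  also have "\<dots> = (\<Sum>c\<in>C. a * f (inc x c) + dep x c * f (dec x c))"
  proof (intro sum.cong refl)
    fix c assume c: "c \<in> C"
    have "(\<Sum>y\<in>?A. ((if y = inc x c then a else 0) + (if 0 < x c \<and> y = dec x c then dep x c else 0)) * f y) =
        (\<Sum>y\<in>?A. if y = inc x c then a * f (inc x c) else 0) +
        (\<Sum>y\<in>?A. if y = dec x c then dep x c * f (dec x c) else 0)"
      unfolding sum.distrib[symmetric] by (intro sum.cong) (auto simp: dep_eq algebra_simps)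
    also have "\<dots> = a * f (inc x c) + dep x c * f (dec x c)"
      using c by (simp add: sum.delta)
    finally show "(\<Sum>y\<in>?A. ((if y = inc x c then a else 0) + (if 0 < x c \<and> y = dec x c then dep x c else 0)) * f y) =
        a * f (inc x c) + dep x c * f (dec x c)" .
  qed
  finally show ?thesis .
qed

lemma exit_network: "exit_rate (network_rate n d lam) x = real n * lam + busy x"
  using flow_const[of 1 x] a_card_C sum_dep[of x] by (simp add: flow_network sum.distrib mult.commute)

sublocale bounded_rates "network_rate n d lam" "real n * lam" "real n * lam + real n"
  using n_pos lam_pos busy_bounds by unfold_locales (auto simp: exit_network)

lemma drift_network:
  "flow f x - exit_rate (network_rate n d lam) x * f x =
    (\<Sum>c\<in>C. a * (f (inc x c) - f x)) + (\<Sum>c\<in>C. dep x c * (f (dec x c) - f x))"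
proof -
  have "exit_rate (network_rate n d lam) x * f x = (\<Sum>c\<in>C. a * f x + dep x c * f x)"
    using flow_const[of "f x" x] by (simp add: flow_network)
  then show ?thesis
    by (simp add: flow_network sum_subtractf[symmetric] sum.distrib[symmetric] algebra_simps)
qed

section \<open>Drift of the first and second moments of the queue lengths\<close>

lemma queue_inc:
  assumes "c \<in> C"
  shows "Q (inc x c) j = Q x j + of_bool (j \<in> c)"
proof -
  have "Q (inc x c) j = (\<Sum>c'\<in>{c \<in> C. j \<in> c}. x c' + of_bool (c' = c))"
    unfolding queue_length_def by (intro sum.cong) auto
  also have "\<dots> = Q x j + (\<Sum>c'\<in>{c \<in> C. j \<in> c}. of_bool (c' = c))"
    by (simp only: sum.distrib queue_length_def)
  also have "(\<Sum>c'\<in>{c \<in> C. j \<in> c}. of_bool (c' = c)) = (\<Sum>c'\<in>{c \<in> C. j \<in> c}. if c' = c then 1 else (0 :: nat))"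
    by (intro sum.cong) auto
  also have "\<dots> = of_bool (j \<in> c)"
    using assms by (simp add: sum.delta)
  finally show ?thesis .
qed

lemma queue_dec:
  assumes "c \<in> C" "0 < x c"
  shows "real (Q (dec x c) j) = real (Q x j) - of_bool (j \<in> c)"
proof -
  have "inc (dec x c) c = x"
    using assms by auto
  then show ?thesis
    using queue_inc[OF assms(1), of "dec x c" j] by simp
qed

definition load :: "(nat set \<Rightarrow> nat) \<Rightarrow> real" where
  "load x = (\<Sum>j=1..n. real (Q x j))"

definition energy :: "(nat set \<Rightarrow> nat) \<Rightarrow> real" where
  "energy x = (\<Sum>j=1..n. (real (Q x j))\<^sup>2)"

lemma load_nonneg: "0 \<le> load x"
  by (simp add: load_def sum_nonneg)

lemma energy_nonneg: "0 \<le> energy x"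
  by (simp add: energy_def sum_nonneg)

lemma sum_of_bool_class:
  "c \<in> C \<Longrightarrow> (\<Sum>j=1..n. of_bool (j \<in> c) * g j) = (\<Sum>j\<in>c. g j)" for g :: "nat \<Rightarrow> real"
  by (intro sum.mono_neutral_cong_right) (auto simp: classes_def)

lemma load_eq: "load x = real d * (\<Sum>c\<in>C. real (x c))"
proof -
  have "load x = (\<Sum>c\<in>C. \<Sum>j\<in>c. real (x c))"
    unfolding sum_class_swap by (simp add: load_def queue_length_def)
  also have "\<dots> = real d * (\<Sum>c\<in>C. real (x c))"
    unfolding sum_distrib_left by (intro sum.cong) (auto simp: classes_def)
  finally show ?thesis .
qed

text \<open>An exact identity: each arrival adds \<open>d\<close> to the load and each departure
  removes \<open>d\<close>, at total rates \<open>n\<close> \<lambda> and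
  \<open>busy x\<close>.\<close>

lemma load_drift:
  "flow load x + real d * busy x = exit_rate (network_rate n d lam) x * load x + real d * (real n * lam)"
proof -
  have i: "load (inc x c) - load x = real d" if "c \<in> C" for c
    using sum_of_bool_class[OF that, of "\<lambda>_. 1"] that
    by (simp add: load_def queue_inc sum.distrib classes_def)
  have o: "dep x c * (load (dec x c) - load x) = dep x c * (- real d)" if "c \<in> C" for c
  proof (cases "x c = 0")
    case False
    then have "load (dec x c) - load x = - real d"
      using sum_of_bool_class[OF that, of "\<lambda>_. 1"] that
      by (simp add: load_def queue_dec sum_subtractf classes_def)
    then show ?thesis by simp
  qed (simp add: dep_eq)
  have "flow load x - exit_rate (network_rate n d lam) x * load x = (\<Sum>c\<in>C. a * real d) + (\<Sum>c\<in>C. dep x c * (- real d))"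
    unfolding drift_network using i o by (intro arg_cong2[of _ _ _ _ "(+)"] sum.cong) auto
  also have "\<dots> = (a * real (card C)) * real d - busy x * real d"
    by (simp add: sum_distrib_right[symmetric] sum_negf sum_dep)
  finally show ?thesis
    unfolding a_card_C by (simp add: algebra_simps)
qed

text \<open>Changing a queue by one changes its square by 1 + 2 q or 1 - 2 q. Arrivals reach each
  server at rate \<lambda> \<open>d\<close>. A class departs at rate \<open>x c\<close> times the
  sum of the 1 / q, and the change contains -2 times the sum of the q; the product of the sums is at
  least the square of \<open>d\<close>. Summed over classes, \<open>load_eq\<close> turns this into
  - 2 \<open>d\<close> times the load.\<close>

lemma energy_drift:
  "flow energy x + 2 * real d * (1 - lam) * load x \<le>
    exit_rate (network_rate n d lam) x * energy x + (lam * real d * real n + real d * busy x)"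
proof -
  have i: "energy (inc x c) - energy x = (\<Sum>j\<in>c. 2 * real (Q x j) + 1)" if "c \<in> C" for c
  proof -
    have "energy (inc x c) - energy x = (\<Sum>j=1..n. of_bool (j \<in> c) * (2 * real (Q x j) + 1))"
      unfolding energy_def sum_subtractf[symmetric] using that
      by (intro sum.cong) (auto simp: queue_inc power2_eq_square algebra_simps)
    then show ?thesis
      using sum_of_bool_class[OF that] by simp
  qed
  have o: "dep x c * (energy (dec x c) - energy x) \<le> real d * dep x c - 2 * ((real d)\<^sup>2 * real (x c))" if c: "c \<in> C" for c
  proof (cases "x c = 0")
    case False
    have "energy (dec x c) - energy x = (\<Sum>j=1..n. of_bool (j \<in> c) * (1 - 2 * real (Q x j)))"
      unfolding energy_def sum_subtractf[symmetric] using c False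
      by (intro sum.cong) (auto simp: queue_dec power2_eq_square algebra_simps)
    also have "\<dots> = (\<Sum>j\<in>c. 1 - 2 * real (Q x j))"
      by (rule sum_of_bool_class[OF c])
    also have "\<dots> = real d - 2 * (\<Sum>j\<in>c. real (Q x j))"
      using c by (simp add: sum_subtractf sum_distrib_left classes_def)
    finally have e0: "energy (dec x c) - energy x = real d - 2 * (\<Sum>j\<in>c. real (Q x j))" .
    have e: "dep x c * (energy (dec x c) - energy x) =
        real d * dep x c - 2 * (real (x c) * ((\<Sum>j\<in>c. 1 / real (Q x j)) * (\<Sum>j\<in>c. real (Q x j))))"
      unfolding e0 dep_eq by (simp add: algebra_simps)
    have "(real (card c))\<^sup>2 \<le> (\<Sum>j\<in>c. 1 / real (Q x j)) * (\<Sum>j\<in>c. real (Q x j))"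
      using le_queue[OF c, of _ x] False by (intro square_le_sum_times_sum_inverse) fastforce
    then have "real (x c) * (real d)\<^sup>2 \<le> real (x c) * ((\<Sum>j\<in>c. 1 / real (Q x j)) * (\<Sum>j\<in>c. real (Q x j)))"
      using c by (intro mult_left_mono) (auto simp: classes_def)
    then show ?thesis
      unfolding e by (simp add: mult.commute)
  qed (simp add: dep_eq)
  have "(\<Sum>c\<in>C. a * (energy (inc x c) - energy x)) = (\<Sum>c\<in>C. \<Sum>j\<in>c. a * (2 * real (Q x j) + 1))"
    using i by (simp add: sum_distrib_left)
  also have "\<dots> = (\<Sum>j=1..n. (a * real (card {c \<in> C. j \<in> c})) * (2 * real (Q x j) + 1))"
    unfolding sum_class_swap by (simp add: mult_ac)
  also have "\<dots> = (\<Sum>j=1..n. lam * real d * (2 * real (Q x j) + 1))"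
    by (intro sum.cong refl) (simp add: a_card_containing)
  also have "\<dots> = lam * real d * (2 * load x + real n)"
    by (simp add: load_def sum.distrib flip: sum_distrib_left)
  finally have I: "(\<Sum>c\<in>C. a * (energy (inc x c) - energy x)) = lam * real d * (2 * load x + real n)" .
  have "(\<Sum>c\<in>C. dep x c * (energy (dec x c) - energy x)) \<le> (\<Sum>c\<in>C. real d * dep x c - 2 * ((real d)\<^sup>2 * real (x c)))"
    using o by (intro sum_mono)
  also have "\<dots> = real d * busy x - 2 * real d * load x"
    by (simp add: load_eq sum_subtractf sum_distrib_left sum_dep[symmetric] power2_eq_square mult_ac)
  finally have "flow energy x - exit_rate (network_rate n d lam) x * energy x \<le>
      lam * real d * (2 * load x + real n) + (real d * busy x - 2 * real d * load x)"
    unfolding drift_network I by simp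
  then show ?thesis
    by (simp add: algebra_simps)
qed

subsection \<open>Positive recurrence of the network\<close>

lemma states_closed: "x \<in> states n d \<Longrightarrow> nbrs x \<subseteq> states n d"
proof
  fix y assume x: "x \<in> states n d" and "y \<in> nbrs x"
  then have "network_rate n d lam x y \<noteq> 0"
    by (simp add: nbrs_def)
  then show "y \<in> states n d"
    by (rule network_rate_cases) (use x in \<open>auto simp: states_def\<close>)
qed

lemma edge_inc: "c \<in> C \<Longrightarrow> (x, inc x c) \<in> edges"
proof -
  assume c: "c \<in> C"
  have "a \<le> network_rate n d lam x (inc x c)"
    unfolding network_rate_eq using c a_pos dep_nonneg
    by (intro order_trans[OF _ member_le_sum[of c]]) (auto simp: less_imp_le)
  then show ?thesis
    using a_pos by simp
qed

lemma edge_dec: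
  assumes c: "c \<in> C" "0 < x c"
  shows "(x, dec x c) \<in> edges"
proof -
  have "dep x c \<le> network_rate n d lam x (dec x c)"
    unfolding network_rate_eq using c a_pos dep_nonneg
    by (intro order_trans[OF _ member_le_sum[of c]]) (auto simp: less_imp_le)
  then show ?thesis
    using dep_pos[of c x] c by simp
qed

text \<open>All states communicate through the empty one. Removing one job and adding it back
  handles both directions in a single induction on the number of jobs.\<close>

lemma reach_empty:
  assumes "x \<in> states n d"
  shows "(x, \<lambda>_. 0) \<in> edges\<^sup>* \<and> (\<lambda>_. 0, x) \<in> edges\<^sup>*"
  using assms
proof (induction "\<Sum>c\<in>C. x c" arbitrary: x rule: less_induct)
  case less
  show ?case
  proof (cases "\<exists>c\<in>C. 0 < x c")
    case True
    then obtain c where c: "c \<in> C" "0 < x c" by blast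
    have "sum (dec x c) C < sum x C"
      using c by (intro sum_strict_mono_ex1) (auto intro!: bexI[of _ c])
    moreover have "dec x c \<in> states n d"
      using less.prems c by (auto simp: states_def)
    ultimately have IH: "(dec x c, \<lambda>_. 0) \<in> edges\<^sup>* \<and> (\<lambda>_. 0, dec x c) \<in> edges\<^sup>*"
      by (rule less.hyps)
    have e: "(dec x c, x) \<in> edges"
      using edge_inc[OF c(1), of "dec x c"] c by simp
    show ?thesis
      using converse_rtrancl_into_rtrancl[OF edge_dec[of c x, OF c] conjunct1[OF IH]]
        rtrancl_into_rtrancl[OF conjunct2[OF IH] e] by (rule conjI)
  next
    case False
    have "x = (\<lambda>_. 0)"
    proof
      fix c
      show "x c = 0"
      proof (cases "c \<in> C")
        case True
        then show ?thesis using False by (meson neq0_conv)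
      next
        case False
        then show ?thesis using less.prems unfolding states_def by blast
      qed
    qed
    then show ?thesis
      by (metis rtrancl.rtrancl_refl)
  qed
qed

lemma states_reach: "x \<in> states n d \<Longrightarrow> y \<in> states n d \<Longrightarrow> (x, y) \<in> edges\<^sup>*"
  by (rule rtrancl_trans[OF conjunct1[OF reach_empty] conjunct2[OF reach_empty]])

lemma finite_load_less: "finite {x \<in> states n d. load x < B}"
proof (rule finite_subset)
  show "finite {x. \<forall>c. (c \<in> C \<longrightarrow> x c \<in> {..nat \<lceil>B\<rceil>}) \<and> (c \<notin> C \<longrightarrow> x c = 0)}"
    by (rule finite_set_of_finite_funs) auto
  show "{x \<in> states n d. load x < B} \<subseteq> {x. \<forall>c. (c \<in> C \<longrightarrow> x c \<in> {..nat \<lceil>B\<rceil>}) \<and> (c \<notin> C \<longrightarrow> x c = 0)}"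
  proof safe
    fix x c assume x: "x \<in> states n d" "load x < B"
    show "x c = 0" if "c \<notin> C"
      using x that by (simp add: states_def)
    show "x c \<le> nat \<lceil>B\<rceil>" if c: "c \<in> C"
    proof -
      have "real (x c) \<le> (\<Sum>c\<in>C. real (x c))"
        using c by (intro member_le_sum) auto
      also have "\<dots> \<le> real d * (\<Sum>c\<in>C. real (x c))"
        using mult_right_mono[of 1 "real d" "\<Sum>c\<in>C. real (x c)"] d_pos by (simp add: sum_nonneg)
      also have "\<dots> < B"
        using x by (simp add: load_eq)
      finally show ?thesis
        by linarith
    qed
  qed
qed

lemma network_positive_recurrent: "positive_recurrent_ctmc (states n d) (network_rate n d lam)"
  unfolding positive_recurrent_ctmc_def
proof (intro conjI ballI)
  show "irreducible_ctmc (states n d) (network_rate n d lam)"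
    using states_reach by (rule irreducible_ctmcI)
  fix x assume x: "x \<in> states n d"
  define k where "k = 2 * real d * (1 - lam)"
  \<comment> \<open>The constants in \<open>energy_drift\<close> with \<open>busy\<close> replaced
    by its bound \<open>n\<close>, plus the upper bound of the exit rate, since Foster's condition
    asks for a decrease by the exit rate. Where the load is at least \<open>b / k\<close>, the
    negative drift absorbs them all.\<close>
  define b where "b = lam * real d * real n + real d * real n + (real n * lam + real n)"
  have k: "0 < k"
    using d_pos lam_less by (simp add: k_def)
  show "positive_recurrent_state (network_rate n d lam) x"
  proof (rule positive_recurrent_state_Foster[of "states n d" x energy "{x \<in> states n d. load x < b / k}"])
    show "finite {x \<in> states n d. load x < b / k}"
      by (rule finite_load_less)
    fix y assume "y \<in> states n d - {x \<in> states n d. load x < b / k}"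
    then have "b \<le> k * load y"
      using k by (auto simp: field_simps not_less)
    moreover have "real d * busy y \<le> real d * real n"
      using busy_bounds by (intro mult_left_mono) auto
    ultimately show "flow energy y + exit_rate (network_rate n d lam) y \<le> exit_rate (network_rate n d lam) y * energy y"
      using energy_drift[of y] exit_le[of y] unfolding k_def b_def by linarith
  next
    show "(y, x) \<in> edges\<^sup>*" if "y \<in> states n d" for y
      using that x by (rule states_reach)
  next
    show "nbrs y \<subseteq> states n d" if "y \<in> states n d" for y
      using that by (rule states_closed)
  next
    show "0 \<le> energy y" for y
      by (rule energy_nonneg)
  next
    show "{x \<in> states n d. load x < b / k} \<subseteq> states n d"
      by blast
  qed (rule x)
qed

subsection \<open>The mean queue length\<close>

text \<open>\<open>load / d\<close> is the number of jobs: it grows at rate \<open>n\<close>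
  \<lambda> and shrinks at rate \<open>busy\<close>.\<close>

lemma mean_busy:
  assumes "excessive (states n d) \<pi>"
  shows "(\<integral>\<^sup>+x. ennreal (busy x) \<partial>\<pi>) \<le> ennreal (real n * lam)"
proof -
  have "(\<integral>\<^sup>+x. ennreal (busy x) \<partial>\<pi>) \<le> (\<integral>\<^sup>+x. ennreal (real n * lam) \<partial>\<pi>)"
  proof (rule excessive_drift_bound[OF assms states_closed, where f = "\<lambda>x. 1 / real d * load x"])
    fix x
    show "flow (\<lambda>x. 1 / real d * load x) x + busy x \<le>
        exit_rate (network_rate n d lam) x * (1 / real d * load x) + real n * lam"
      unfolding flow_cmult using load_drift[of x] d_pos by (simp add: field_simps)
  qed (use busy_bounds load_nonneg lam_pos in auto)
  then show ?thesis by simp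
qed

lemma mean_load:
  assumes "excessive (states n d) \<pi>"
  shows "(\<integral>\<^sup>+x. ennreal (load x) \<partial>\<pi>) \<le> ennreal (real n * (lam / (1 - lam)))"
proof -
  let ?k = "2 * (1 - lam)"
  have k: "0 < ?k"
    using lam_less by simp
  have "(\<integral>\<^sup>+x. ennreal (load x) \<partial>\<pi>) \<le> (\<integral>\<^sup>+x. ennreal (lam * real n / ?k + busy x / ?k) \<partial>\<pi>)"
  \<comment> \<open>The scaling makes the coefficient of the load in the drift equal to 1; the
    factor \<open>d\<close> drops out of the bound.\<close>
  proof (rule excessive_drift_bound[OF assms states_closed, where f = "\<lambda>x. 1 / (real d * ?k) * energy x"])
    fix x
    have "flow energy x + (real d * ?k) * load x \<le>
        exit_rate (network_rate n d lam) x * energy x + real d * (lam * real n + busy x)"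
      using energy_drift[of x] by (simp add: algebra_simps)
    then have "(flow energy x + (real d * ?k) * load x) / (real d * ?k) \<le>
        (exit_rate (network_rate n d lam) x * energy x + real d * (lam * real n + busy x)) / (real d * ?k)"
      using k by (intro divide_right_mono) auto
    then show "flow (\<lambda>x. 1 / (real d * ?k) * energy x) x + load x \<le>
        exit_rate (network_rate n d lam) x * (1 / (real d * ?k) * energy x) + (lam * real n / ?k + busy x / ?k)"
      unfolding flow_cmult using k d_pos by (simp add: add_divide_distrib)
  qed (use busy_bounds load_nonneg energy_nonneg lam_pos k in auto)
  also have "\<dots> = (\<integral>\<^sup>+x. ennreal (lam * real n / ?k) + ennreal (1 / ?k) * ennreal (busy x) \<partial>\<pi>)"
    using lam_pos k busy_bounds by (intro nn_integral_cong) (simp flip: ennreal_mult ennreal_plus)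
  also have "\<dots> = ennreal (lam * real n / ?k) + ennreal (1 / ?k) * (\<integral>\<^sup>+x. ennreal (busy x) \<partial>\<pi>)"
    by (simp add: nn_integral_add nn_integral_cmult)
  also have "\<dots> \<le> ennreal (lam * real n / ?k) + ennreal (1 / ?k) * ennreal (real n * lam)"
    using mean_busy[OF assms] by (intro add_left_mono mult_left_mono) auto
  also have "\<dots> = ennreal (lam * real n / ?k + 1 / ?k * (real n * lam))"
    using lam_pos k by (simp flip: ennreal_plus ennreal_mult)
  also have "lam * real n / ?k + 1 / ?k * (real n * lam) = real n * (lam / (1 - lam))"
  proof -
    have "y / (2 * c) + 1 / (2 * c) * y = y / c" if "c \<noteq> 0" for y c :: real
      using that by (simp add: field_simps)
    from this[of "1 - lam" "real n * lam"] show ?thesis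
      using lam_less by (simp add: mult.commute)
  qed
  finally show ?thesis .
qed

section \<open>Symmetry under relabelling of the servers\<close>

context
  fixes \<tau> :: "nat \<Rightarrow> nat"
  assumes \<tau>_invol: "\<And>i. \<tau> (\<tau> i) = i" and \<tau>_range: "\<tau> ` {1..n} = {1..n}"
begin

text \<open>Since \<open>\<tau>\<close> is an involution, so is \<open>relabel\<close>, and no
  inverse permutation has to be carried along. Swaps of two servers are enough to compare any two
  queues.\<close>

definition relabel :: "(nat set \<Rightarrow> nat) \<Rightarrow> nat set \<Rightarrow> nat" where
  "relabel x c = x (\<tau> ` c)"

lemma image_\<tau>_image [simp]: "\<tau> ` \<tau> ` c = c"
  by (simp add: image_image \<tau>_invol)

lemma mem_image_\<tau>: "j \<in> \<tau> ` c \<longleftrightarrow> \<tau> j \<in> c"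
  by (metis \<tau>_invol image_iff)

lemma inj_\<tau>: "inj \<tau>"
  by (metis \<tau>_invol injI)

lemma image_\<tau>_class [simp]: "\<tau> ` c \<in> C \<longleftrightarrow> c \<in> C"
proof -
  have "\<tau> ` c \<in> C" if "c \<in> C" for c
    using that \<tau>_range card_image[OF inj_on_subset[OF inj_\<tau> subset_UNIV]] by (fastforce simp: classes_def)
  from this[of c] this[of "\<tau> ` c"] show ?thesis by auto
qed

lemma relabel_relabel [simp]: "relabel (relabel x) = x"
  by (simp add: relabel_def fun_eq_iff)

lemma sum_relabel: "(\<Sum>c\<in>C. f (\<tau> ` c)) = (\<Sum>c\<in>C. f c)"
  by (rule sum.reindex_bij_witness[of _ "image \<tau>" "image \<tau>"]) auto

lemma relabel_states [simp]: "relabel x \<in> states n d \<longleftrightarrow> x \<in> states n d"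
proof -
  have "relabel x \<in> states n d" if "x \<in> states n d" for x
    using that by (auto simp: states_def relabel_def)
  from this[of x] this[of "relabel x"] show ?thesis by auto
qed

lemma queue_relabel: "Q (relabel x) j = Q x (\<tau> j)"
  unfolding queue_length_def relabel_def
  by (rule sum.reindex_bij_witness[of _ "image \<tau>" "image \<tau>"])
    (auto simp: \<tau>_invol mem_image_\<tau>)

lemma relabel_upd: "relabel (x(c := k)) = (relabel x)(\<tau> ` c := k)"
proof
  fix c'
  have "\<tau> ` c' = c \<longleftrightarrow> c' = \<tau> ` c"
    by (metis image_\<tau>_image)
  then show "relabel (x(c := k)) c' = ((relabel x)(\<tau> ` c := k)) c'"
    by (simp add: relabel_def)
qed

lemma dep_relabel: "dep (relabel x) c = dep x (\<tau> ` c)"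
proof -
  have "(\<Sum>j\<in>c. 1 / real (Q x (\<tau> j))) = (\<Sum>j\<in>\<tau> ` c. 1 / real (Q x j))"
    by (subst sum.reindex) (auto intro: inj_on_subset[OF inj_\<tau>])
  then show ?thesis
    by (simp add: dep_eq queue_relabel relabel_def)
qed

lemma relabel_eq_iff: "relabel x = y \<longleftrightarrow> x = relabel y"
  by auto

text \<open>Invariance of the rates, with the relabelling moved from the source to the target: this
  is the form met when integrating the inflow under \<open>map_pmf relabel\<close>.\<close>

lemma rate_relabel: "network_rate n d lam (relabel x) y = network_rate n d lam x (relabel y)"
proof -
  have "network_rate n d lam (relabel x) y = (\<Sum>c\<in>C. (if y = relabel (inc x (\<tau> ` c)) then a else 0) +
      (if 0 < x (\<tau> ` c) \<and> y = relabel (dec x (\<tau> ` c)) then dep x (\<tau> ` c) else 0))"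
    unfolding network_rate_eq by (simp add: relabel_upd dep_relabel relabel_def[of _ "_ :: nat set"] cong: if_cong)
  also have "\<dots> = (\<Sum>c\<in>C. (if y = relabel (inc x c) then a else 0) +
      (if 0 < x c \<and> y = relabel (dec x c) then dep x c else 0))"
    by (rule sum_relabel)
  also have "\<dots> = network_rate n d lam x (relabel y)"
    unfolding network_rate_eq by (simp add: relabel_eq_iff[symmetric] eq_commute[of y])
  finally show ?thesis .
qed

lemma exit_relabel: "exit_rate (network_rate n d lam) (relabel x) = exit_rate (network_rate n d lam) x"
  unfolding exit_network sum_dep[symmetric] dep_relabel by (simp add: sum_relabel)

lemma excessive_relabel:
  assumes ex: "excessive (states n d) \<pi>"
  shows "excessive (states n d) (map_pmf relabel \<pi>)"
  unfolding excessive_def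
proof (intro conjI ballI)
  show "set_pmf (map_pmf relabel \<pi>) \<subseteq> states n d"
    using ex by (auto simp: excessive_def)
  fix y assume y: "y \<in> states n d"
  have "(\<integral>\<^sup>+x. ennreal (network_rate n d lam x y) \<partial>map_pmf relabel \<pi>) =
      (\<integral>\<^sup>+x. ennreal (network_rate n d lam x (relabel y)) \<partial>\<pi>)"
    by (simp add: rate_relabel)
  also have "\<dots> \<le> ennreal (exit_rate (network_rate n d lam) (relabel y) * pmf \<pi> (relabel y))"
    using ex y by (simp add: excessive_def)
  also have "pmf \<pi> (relabel y) = pmf (map_pmf relabel \<pi>) (relabel (relabel y))"
    by (rule pmf_map_inj'[symmetric]) (metis injI relabel_relabel)
  finally show "(\<integral>\<^sup>+x. ennreal (network_rate n d lam x y) \<partial>map_pmf relabel \<pi>) \<le>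
      ennreal (exit_rate (network_rate n d lam) y * pmf (map_pmf relabel \<pi>) y)"
    by (simp add: exit_relabel)
qed

lemma mean_queue_relabel:
  assumes ex: "excessive (states n d) \<pi>"
  shows "(\<integral>\<^sup>+x. ennreal (Q x (\<tau> j)) \<partial>\<pi>) = (\<integral>\<^sup>+x. ennreal (Q x j) \<partial>\<pi>)"
proof -
  \<comment> \<open>Both laws are excessive on the same closed, communicating set of states.\<close>
  have "\<pi> = map_pmf relabel \<pi>"
    using ex excessive_relabel[OF ex] states_closed states_reach by (rule excessive_unique)
  then have "(\<integral>\<^sup>+x. ennreal (Q x j) \<partial>\<pi>) = (\<integral>\<^sup>+x. ennreal (Q x j) \<partial>map_pmf relabel \<pi>)"
    by simp
  also have "\<dots> = (\<integral>\<^sup>+x. ennreal (Q x (\<tau> j)) \<partial>\<pi>)"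
    by (simp add: queue_relabel)
  finally show ?thesis by simp
qed

end

lemma mean_queue_eq:
  assumes ex: "excessive (states n d) \<pi>" and "i \<in> {1..n}" "j \<in> {1..n}"
  shows "(\<integral>\<^sup>+x. ennreal (Q x i) \<partial>\<pi>) = (\<integral>\<^sup>+x. ennreal (Q x j) \<partial>\<pi>)"
proof -
  let ?\<tau> = "Transposition.transpose i j"
  have "(\<integral>\<^sup>+x. ennreal (Q x (?\<tau> j)) \<partial>\<pi>) = (\<integral>\<^sup>+x. ennreal (Q x j) \<partial>\<pi>)"
    using assms by (intro mean_queue_relabel ex) simp_all
  then show ?thesis by simp
qed

lemma mean_queue:
  assumes ex: "excessive (states n d) \<pi>" and j: "j \<in> {1..n}"
  shows "(\<integral>\<^sup>+x. ennreal (Q x j) \<partial>\<pi>) \<le> ennreal (lam / (1 - lam))"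
proof -
  have "ennreal (real n) * (\<integral>\<^sup>+x. ennreal (Q x j) \<partial>\<pi>) = (\<Sum>i=1..n. \<integral>\<^sup>+x. ennreal (Q x j) \<partial>\<pi>)"
    by (simp add: ennreal_of_nat_eq_real_of_nat)
  also have "\<dots> = (\<Sum>i=1..n. \<integral>\<^sup>+x. ennreal (Q x i) \<partial>\<pi>)"
    using mean_queue_eq[OF ex _ j] by (intro sum.cong) auto
  also have "\<dots> = (\<integral>\<^sup>+x. ennreal (load x) \<partial>\<pi>)"
    unfolding load_def by (subst nn_integral_sum[symmetric]) (auto intro!: nn_integral_cong simp: sum_ennreal)
  also have "\<dots> \<le> ennreal (real n) * ennreal (lam / (1 - lam))"
    using mean_load[OF ex] lam_pos lam_less by (subst ennreal_mult[symmetric]) auto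
  finally show ?thesis
    using n_pos by (simp add: ennreal_mult_le_mult_iff)
qed

end

theorem theorem2:
  fixes d :: nat and lam :: real
  assumes "d \<ge> 1" and "0 < lam" and "lam < 1"
  shows "(\<forall>n\<ge>d. positive_recurrent_ctmc (states n d) (network_rate n d lam)) \<and>
    (SUP n\<in>{d..}. SUP j\<in>{1..n}.
       SUP \<pi>\<in>{\<pi>. stationary_distribution (states n d) (network_rate n d lam) \<pi>}.
         \<integral>\<^sup>+ q. of_nat q \<partial>measure_pmf (map_pmf (\<lambda>x. queue_length n d x j) \<pi>))
      \<le> ennreal (lam / (1 - lam))"
proof (intro conjI allI impI SUP_least)
  fix n assume "d \<le> n"
  with assms interpret queueing_network n d lam
    by unfold_locales auto
  show "positive_recurrent_ctmc (states n d) (network_rate n d lam)"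
    by (rule network_positive_recurrent)
next
  fix n j \<pi>
  assume n: "n \<in> {d..}" and j: "j \<in> {1..n}"
    and \<pi>: "\<pi> \<in> {\<pi>. stationary_distribution (states n d) (network_rate n d lam) \<pi>}"
  from n assms interpret queueing_network n d lam
    by unfold_locales auto
  have "excessive (states n d) \<pi>"
    using \<pi> stationary_imp_excessive by blast
  then show "(\<integral>\<^sup>+ q. of_nat q \<partial>measure_pmf (map_pmf (\<lambda>x. queue_length n d x j) \<pi>)) \<le> ennreal (lam / (1 - lam))"
    using mean_queue[of \<pi> j] j by (simp add: ennreal_of_nat_eq_real_of_nat)
qed

end
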